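(* Let $\mathbb{K}$ be a field, let $G$ be a tree with vertex set $\{x_1,\ldots,x_n\}$, let $S=\mathbb{K}[x_1,\ldots,x_n]$, and let $J(G)\subset S$ be the vertex cover ideal of $G$. Then for every integer $k\ge 1$, the ordinary power $J(G)^k$ has linear quotients, and hence $J(G)^k$ is componentwise linear.
   Context: The vertex cover ideal of a finite simple graph $G$ on vertex set $\{x_1,\ldots,x_n\}$ with edge set $E(G)$ is the ideal $J(G)=\bigcap_{\{x_i,x_j\}\in E(G)}\langle x_i,x_j\rangle$ of $S=\mathbb{K}[x_1,\ldots,x_n]$. A monomial ideal $I\subset S$ has linear quotients if there is an ordering $u_1,\ldots,u_r$ of its minimal monomial generators such that for every $i$ the colon ideal $\langle u_1,\ldots,u_{i-1}\rangle:\langle u_i\rangle$ is generated by a subset of the variables $\{x_1,\ldots,x_n\}$. The ring $S$ is standard graded. A finitely generated graded $S$-module $M$ has a linear resolution if for some integer $d$ its graded Betti numbers satisfy $\beta_{i,i+b}(M)=0$ for all $i$ and all $b\ne d$, where $\beta_{i,j}(M)=\dim_{\mathbb{K}}\operatorname{Tor}_i^S(M,\mathbb{K})_j$. For a graded ideal $I\subset S$, $I_{<j>}$ denotes the ideal generated by all degree $j$ elements of $I$; $I$ is componentwise linear if $I_{<j>}$ has a linear resolution for all $j$. *)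

theory Defs
  imports Complex_Main "HOL-Library.Poly_Mapping"
begin

section \<open>Finite simple graphs and trees\<close>

text \<open>A simple graph is given by its edge set; all elements of the type \<open>'v\<close> are vertices.\<close>

definition simple_graph :: "'v set set \<Rightarrow> bool" where
  "simple_graph E \<longleftrightarrow> (\<forall>e\<in>E. card e = 2)"

definition connected_graph :: "'v set set \<Rightarrow> bool" where
  "connected_graph E \<longleftrightarrow> (\<forall>u v. (u, v) \<in> {(a, b). {a, b} \<in> E}\<^sup>*)"

definition graph_cycle :: "'v set set \<Rightarrow> 'v list \<Rightarrow> bool" where
  "graph_cycle E c \<longleftrightarrow> length c \<ge> 3 \<and> distinct c \<and>
     (\<forall>i<length c. {c ! i, c ! (Suc i mod length c)} \<in> E)"

definition tree_graph :: "'v set set \<Rightarrow> bool" where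
  "tree_graph E \<longleftrightarrow> simple_graph E \<and> connected_graph E \<and> (\<nexists>c. graph_cycle E c)"


section \<open>The polynomial ring and its ideals\<close>

text \<open>\<open>('v, 'k) mpoly\<close> is the polynomial ring over \<open>'k\<close> with one variable for each
  element of \<open>'v\<close>; an exponent vector is an element of \<open>'v \<Rightarrow>\<^sub>0 nat\<close>.\<close>

type_synonym ('v, 'k) mpoly = "('v \<Rightarrow>\<^sub>0 nat) \<Rightarrow>\<^sub>0 'k"

definition monomial :: "('v \<Rightarrow>\<^sub>0 nat) \<Rightarrow> ('v, 'k::field) mpoly" where
  "monomial m = Poly_Mapping.single m 1"

definition var :: "'v \<Rightarrow> ('v, 'k::field) mpoly" where
  "var x = monomial (Poly_Mapping.single x 1)"

definition homogeneous :: "int \<Rightarrow> ('v::finite, 'k::field) mpoly set" where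
  "homogeneous j =
     {f. \<forall>m\<in>Poly_Mapping.keys f. int (\<Sum>x\<in>UNIV. Poly_Mapping.lookup m x) = j}"

definition ideal_gen :: "'a::comm_ring_1 set \<Rightarrow> 'a set" where
  "ideal_gen A = module.span (*) A"

primrec ideal_power :: "'a::comm_ring_1 set \<Rightarrow> nat \<Rightarrow> 'a set" where
  "ideal_power I 0 = UNIV"
| "ideal_power I (Suc k) = ideal_gen {a * b |a b. a \<in> I \<and> b \<in> ideal_power I k}"

definition colon :: "'a::comm_ring_1 set \<Rightarrow> 'a set \<Rightarrow> 'a set" where
  "colon I J = {f. \<forall>g\<in>J. f * g \<in> I}"

definition vertex_cover_ideal :: "'v set set \<Rightarrow> ('v, 'k::field) mpoly set" where
  "vertex_cover_ideal E = (\<Inter>e\<in>E. ideal_gen (var ` e))"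


section \<open>Linear quotients\<close>

definition minimal_monomial_generators ::
    "('v, 'k::field) mpoly set \<Rightarrow> ('v, 'k) mpoly set \<Rightarrow> bool" where
  "minimal_monomial_generators A I \<longleftrightarrow>
     A \<subseteq> range monomial \<and> ideal_gen A = I \<and> (\<forall>B. B \<subset> A \<longrightarrow> ideal_gen B \<noteq> I)"

definition linear_quotients :: "('v, 'k::field) mpoly set \<Rightarrow> bool" where
  "linear_quotients I \<longleftrightarrow>
     (\<exists>us. distinct us \<and> minimal_monomial_generators (set us) I \<and>
        (\<forall>i<length us. \<exists>V.
           colon (ideal_gen (set (take i us))) (ideal_gen {us ! i}) = ideal_gen (var ` V)))"


section \<open>Graded modules, graded free resolutions and Betti numbers\<close>

text \<open>A \<open>\<int>\<close>-graded module over the polynomial ring: \<open>gm_part M j\<close> is the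
  component of degree \<open>j\<close> of \<open>gm_carrier M\<close>.\<close>

record (overloaded) ('v, 'k, 'm) graded_module =
  gm_carrier :: "'m set"
  gm_scale :: "('v, 'k) mpoly \<Rightarrow> 'm \<Rightarrow> 'm"
  gm_part :: "int \<Rightarrow> 'm set"

definition ideal_module ::
    "('v::finite, 'k::field) mpoly set \<Rightarrow> ('v, 'k, ('v, 'k) mpoly) graded_module" where
  "ideal_module I =
     \<lparr> gm_carrier = I, gm_scale = (*), gm_part = (\<lambda>j. I \<inter> homogeneous j) \<rparr>"

text \<open>Free modules of finite rank consist of the finitely supported functions
  \<open>nat \<Rightarrow>\<^sub>0 'r\<close> with support in \<open>{..<n}\<close>; \<open>free_scale\<close> is the coordinatewise scalar
  multiplication, and \<open>lin_ext s b\<close> is the linear map sending the basis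
  vector \<open>e\<^sub>t\<close> to \<open>b t\<close>, where \<open>s\<close> is the scalar multiplication of the target.\<close>

definition free_module :: "nat \<Rightarrow> (nat \<Rightarrow>\<^sub>0 'r::zero) set" where
  "free_module n = {v. Poly_Mapping.keys v \<subseteq> {..<n}}"

definition free_scale :: "'r::comm_ring_1 \<Rightarrow> (nat \<Rightarrow>\<^sub>0 'r) \<Rightarrow> (nat \<Rightarrow>\<^sub>0 'r)" where
  "free_scale c v = Poly_Mapping.map ((*) c) v"

definition lin_ext ::
    "('r \<Rightarrow> 'm \<Rightarrow> 'm) \<Rightarrow> (nat \<Rightarrow> 'm) \<Rightarrow> (nat \<Rightarrow>\<^sub>0 'r::zero) \<Rightarrow> 'm::comm_monoid_add" where
  "lin_ext s b v = (\<Sum>t\<in>Poly_Mapping.keys v. s (Poly_Mapping.lookup v t) (b t))"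

text \<open>The data of an augmented complex of graded free modules
  \[ \cdots \to F_2 \to F_1 \to F_0 \to M: \]
  \<open>F\<^sub>i\<close> has rank \<open>fr_rank F i\<close>, its \<open>t\<close>-th basis vector has degree
  \<open>fr_degree F i t\<close>, the map \<open>F\<^sub>i\<^sub>+\<^sub>1 \<rightarrow> F\<^sub>i\<close> sends the \<open>t\<close>-th basis vector to
  \<open>fr_diff F i t\<close>, and \<open>F\<^sub>0 \<rightarrow> M\<close> sends it to \<open>fr_aug F t\<close>.\<close>

record (overloaded) ('v, 'k, 'm) free_complex =
  fr_rank :: "nat \<Rightarrow> nat"
  fr_degree :: "nat \<Rightarrow> nat \<Rightarrow> int"
  fr_diff :: "nat \<Rightarrow> nat \<Rightarrow> (nat \<Rightarrow>\<^sub>0 ('v, 'k) mpoly)"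
  fr_aug :: "nat \<Rightarrow> 'm"

definition graded_free_resolution ::
    "('v::finite, 'k::field, 'm::ab_group_add) graded_module
     \<Rightarrow> ('v, 'k, 'm) free_complex \<Rightarrow> bool" where
  "graded_free_resolution M F \<longleftrightarrow>
     (\<forall>t<fr_rank F 0. fr_aug F t \<in> gm_part M (fr_degree F 0 t)) \<and>
     (\<forall>i. \<forall>t<fr_rank F (Suc i). fr_diff F i t \<in> free_module (fr_rank F i) \<and>
        (\<forall>s<fr_rank F i. Poly_Mapping.lookup (fr_diff F i t) s
            \<in> homogeneous (fr_degree F (Suc i) t - fr_degree F i s))) \<and>
     lin_ext (gm_scale M) (fr_aug F) ` free_module (fr_rank F 0) = gm_carrier M \<and>
     {v \<in> free_module (fr_rank F 0). lin_ext (gm_scale M) (fr_aug F) v = 0}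
       = lin_ext free_scale (fr_diff F 0) ` free_module (fr_rank F 1) \<and>
     (\<forall>i. {v \<in> free_module (fr_rank F (Suc i)). lin_ext free_scale (fr_diff F i) v = 0}
       = lin_ext free_scale (fr_diff F (Suc i)) ` free_module (fr_rank F (Suc (Suc i))))"

text \<open>The complex \<open>F \<otimes>\<^sub>S K\<close>, where \<open>K\<close> is \<open>S\<close> modulo the ideal of all variables:
  it has the same bases as \<open>F\<close>, over \<open>K\<close>, and the entries of its matrices are the
  constant terms of those of \<open>F\<close>. Its homology in homological degree \<open>i\<close> and internal
  degree \<open>j\<close> is \<open>tor_cycles F i j\<close> modulo \<open>tor_boundaries F i j\<close>.\<close>

definition tensor_part ::
    "('v, 'k::field, 'm) free_complex \<Rightarrow> nat \<Rightarrow> int \<Rightarrow> (nat \<Rightarrow>\<^sub>0 'k) set" where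
  "tensor_part F i j =
     {v \<in> free_module (fr_rank F i). \<forall>t\<in>Poly_Mapping.keys v. fr_degree F i t = j}"

definition tensor_diff ::
    "('v, 'k::field, 'm) free_complex \<Rightarrow> nat \<Rightarrow> (nat \<Rightarrow>\<^sub>0 'k) \<Rightarrow> (nat \<Rightarrow>\<^sub>0 'k)" where
  "tensor_diff F i =
     lin_ext free_scale (\<lambda>t. Poly_Mapping.map (\<lambda>p. Poly_Mapping.lookup p 0) (fr_diff F i t))"

definition tor_cycles ::
    "('v, 'k::field, 'm) free_complex \<Rightarrow> nat \<Rightarrow> int \<Rightarrow> (nat \<Rightarrow>\<^sub>0 'k) set" where
  "tor_cycles F i j =
     {v \<in> tensor_part F i j. case i of 0 \<Rightarrow> True | Suc i' \<Rightarrow> tensor_diff F i' v = 0}"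

definition tor_boundaries ::
    "('v, 'k::field, 'm) free_complex \<Rightarrow> nat \<Rightarrow> int \<Rightarrow> (nat \<Rightarrow>\<^sub>0 'k) set" where
  "tor_boundaries F i j = tensor_diff F i ` tensor_part F (Suc i) j"

text \<open>\<open>betti M i j\<close> is the \<open>K\<close>-dimension of the degree \<open>j\<close> part of \<open>Tor\<^sub>i\<^sup>S(M, K)\<close>,
  computed from an arbitrarily chosen graded free resolution of \<open>M\<close> by modules of finite
  rank. It is meaningful for finitely generated graded modules only, as these are the ones
  that have such a resolution. The subtraction is not truncated for a resolution: the
  boundaries form a subspace of the finite-dimensional space of cycles.\<close>

definition betti ::
    "('v::finite, 'k::field, 'm::ab_group_add) graded_module \<Rightarrow> nat \<Rightarrow> int \<Rightarrow> nat" where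
  "betti M i j =
     (let F = (SOME F. graded_free_resolution M F)
      in vector_space.dim free_scale (tor_cycles F i j)
         - vector_space.dim free_scale (tor_boundaries F i j))"

definition linear_resolution ::
    "('v::finite, 'k::field, 'm::ab_group_add) graded_module \<Rightarrow> bool" where
  "linear_resolution M \<longleftrightarrow>
     (\<exists>d::int. \<forall>i. \<forall>b::int. b \<noteq> d \<longrightarrow> betti M i (int i + b) = 0)"


section \<open>Componentwise linear ideals\<close>

definition graded_ideal :: "('v::finite, 'k::field) mpoly set \<Rightarrow> bool" where
  "graded_ideal I \<longleftrightarrow> (\<exists>A. A \<subseteq> (\<Union>j. homogeneous j) \<and> I = ideal_gen A)"

definition componentwise_linear :: "('v::finite, 'k::field) mpoly set \<Rightarrow> bool" where
  "componentwise_linear I \<longleftrightarrow> graded_ideal I \<and>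
     (\<forall>j. linear_resolution (ideal_module (ideal_gen (I \<inter> homogeneous j))))"

end

theory Submission
  imports Defs
begin

text \<open>
  On monomial ideals the question is combinatorial. A forest is bipartite, and on a
  bipartite graph every exponent vector \<open>a\<close> with
  \<open>a\<^sub>i + a\<^sub>j \<ge> k\<close> on all edges splits into \<open>k\<close> vertex
  covers and a remainder (\<open>weighted_covers_sum\<close>). Hence the \<open>k\<close>-th power of
  the cover ideal is the intersection of the ideals
  \<open>\<langle>x\<^sub>i, x\<^sub>j\<rangle>\<^sup>k\<close>. More generally consider the
  intersection of the ideals \<open>\<langle>x\<^sub>i, x\<^sub>j\<rangle>\<close> raised to
  powers \<open>w i j\<close>, where the pairs with positive weight form a forest. This class is
  closed under the following splitting. Choose a vertex \<open>y\<close> adjacent to a leaf.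
  The covers that use \<open>y\<close> are \<open>y\<close> times covers for a
  smaller weight, and those that avoid \<open>y\<close> are a fixed monomial times covers for
  another smaller weight. Listing the first kind before the second gives linear quotients by
  induction (\<open>linearly_orderable_split\<close>): for a cover of the second kind, the colon
  ideal by the covers of the first kind is generated by \<open>y\<close>. The same splitting is
  applied to the minimal covers (\<open>minimal_covers_linearly_orderable\<close>), which gives the
  linear quotients of the power, and to all covers of a fixed degree
  (\<open>covers_of_degree_linearly_orderable\<close>), which gives linear quotients of
  the ideal generated by each graded piece.

  It remains to see that an ideal generated in a single degree \<open>d\<close> with linear
  quotients has a linear resolution. Linear quotients make sense for generators of a
  submodule of a free module, and they pass to the module of syzygies: looking at last
  nonzero coordinates, the leading ideals of the syzygies are exactly the colon ideals of the
  generators, hence generated by variables, and vectors that realise these variables as leading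
  coordinates generate the syzygies, have linear entries and again have linear quotients
  (\<open>syzygies_variable_quotients\<close>). Iterating gives a resolution whose
  \<open>i\<close>-th module is generated in degree \<open>d + i\<close>.

  The Betti numbers are defined through an arbitrary graded resolution, so it has to be compared
  with this linear one. Graded chain maps in both directions and a homotopy from the
  identity to their composite (\<open>homotopy_equivalence\<close>) show, after reduction modulo the
  variables, that the homology of the arbitrary resolution vanishes outside the
  degrees \<open>d + i\<close> (\<open>tor_vanishes_off_diagonal\<close>).
\<close>

section \<open>Monomial ideals\<close>

interpretation ideal: module "(*) :: 'a::comm_ring_1 \<Rightarrow> 'a \<Rightarrow> 'a"
  by unfold_locales (simp_all add: algebra_simps)

\<comment> \<open>As a rewrite rule this reverses \<open>mult.assoc\<close>, so the two together loop.\<close>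
declare ideal.scale_scale [simp del]

abbreviation lk where "lk \<equiv> Poly_Mapping.lookup"

definition unit_exp :: "'v \<Rightarrow> 'v \<Rightarrow>\<^sub>0 nat" where
  "unit_exp x = Poly_Mapping.single x 1"

lemma lookup_unit_exp: "lk (unit_exp x) z = (if z = x then 1 else 0)"
  by (simp add: unit_exp_def lookup_single when_def)

text \<open>Divisibility of monomials, on exponent vectors. The order \<open>\<le>\<close> of
  \<open>poly_mapping\<close> is lexicographic and cannot be used for this.\<close>

definition mdvd :: "('v \<Rightarrow>\<^sub>0 nat) \<Rightarrow> ('v \<Rightarrow>\<^sub>0 nat) \<Rightarrow> bool" (infix "mdvd" 50) where
  "a mdvd m \<longleftrightarrow> (\<forall>x. lk a x \<le> lk m x)"

lemma mdvd_refl [simp]: "a mdvd a"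
  by (simp add: mdvd_def)

lemma mdvd_trans: "a mdvd b \<Longrightarrow> b mdvd c \<Longrightarrow> a mdvd c"
  by (meson mdvd_def order_trans)

lemma minus_plus_mdvd: "a mdvd m \<Longrightarrow> m - a + a = m"
  by (rule poly_mapping_eqI) (simp add: mdvd_def lookup_add lookup_minus)

lemma mdvd_add [simp]: "a mdvd w + a" "a mdvd a + w"
  by (simp_all add: mdvd_def lookup_add)

lemma mdvd_add_cancel [simp]: "a + c mdvd b + c \<longleftrightarrow> a mdvd b"
  by (simp add: mdvd_def lookup_add)

lemma unit_exp_mdvd: "unit_exp x mdvd m \<longleftrightarrow> lk m x \<ge> 1"
  by (auto simp: mdvd_def lookup_unit_exp)

definition upward :: "('v \<Rightarrow>\<^sub>0 nat) set \<Rightarrow> ('v \<Rightarrow>\<^sub>0 nat) set" where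
  "upward A = {m. \<exists>a\<in>A. a mdvd m}"

text \<open>Every monomial ideal has this form, for an upward closed set \<open>A\<close> of exponents; it turns
  computations with monomial ideals into computations with sets of exponents.\<close>

definition polys_on :: "('v \<Rightarrow>\<^sub>0 nat) set \<Rightarrow> ('v, 'k::field) mpoly set" where
  "polys_on A = {f. Poly_Mapping.keys f \<subseteq> A}"

lemma monomial_inject [simp]: "monomial a = (monomial b :: ('v, 'k::field) mpoly) \<longleftrightarrow> a = b"
proof
  assume "monomial a = (monomial b :: ('v, 'k::field) mpoly)"
  then have "lk (monomial a :: ('v, 'k) mpoly) a = lk (monomial b :: ('v, 'k) mpoly) a" by simp
  then show "a = b" by (simp add: monomial_def lookup_single when_def split: if_splits)
qed simp

lemma keys_monomial [simp]: "Poly_Mapping.keys (monomial m :: ('v, 'k::field) mpoly) = {m}"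
  by (simp add: monomial_def)

lemma monomial_in_polys_on [simp]:
  "(monomial m :: ('v, 'k::field) mpoly) \<in> polys_on A \<longleftrightarrow> m \<in> A"
  by (simp add: polys_on_def)

lemma polys_on_mono: "polys_on A \<subseteq> (polys_on B :: ('v, 'k::field) mpoly set) \<longleftrightarrow> A \<subseteq> B"
proof
  assume *: "polys_on A \<subseteq> (polys_on B :: ('v, 'k::field) mpoly set)"
  show "A \<subseteq> B"
  proof
    fix m assume "m \<in> A"
    then have "(monomial m :: ('v, 'k) mpoly) \<in> polys_on B" using * by (metis monomial_in_polys_on subsetD)
    then show "m \<in> B" by simp
  qed
qed (auto simp: polys_on_def)

lemma polys_on_eq_iff: "polys_on A = (polys_on B :: ('v, 'k::field) mpoly set) \<longleftrightarrow> A = B"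
  by (metis polys_on_mono order_antisym order_refl)

lemma poly_expansion: "(f :: ('v, 'k::field) mpoly) =
    (\<Sum>m\<in>Poly_Mapping.keys f. Poly_Mapping.single m (lk f m))"
  by (rule poly_mapping_eqI)
     (auto simp: lookup_sum lookup_single when_def sum.delta in_keys_iff)

lemma lookup_times_single:
  fixes f :: "('v, 'k::field) mpoly"
  shows "lk (f * Poly_Mapping.single u c) (m + u) = lk f m * c"
proof -
  have "Sum_any (\<lambda>q. lk (Poly_Mapping.single u c) q when m + u = a + q) = (c when a = m)" for a
  proof -
    have "(\<lambda>q. lk (Poly_Mapping.single u c) q when m + u = a + q) = (\<lambda>q. (c when a = m) when q = u)"
      by (rule ext) (auto simp: lookup_single when_def)
    then show ?thesis by (simp only: Sum_any_when_equal)
  qed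
  then show ?thesis by (simp add: lookup_mult mult_when)
qed

lemma keys_times_monomial:
  fixes f :: "('v, 'k::field) mpoly"
  shows "Poly_Mapping.keys (f * monomial u) = (\<lambda>m. m + u) ` Poly_Mapping.keys f"
proof
  show "Poly_Mapping.keys (f * monomial u) \<subseteq> (\<lambda>m. m + u) ` Poly_Mapping.keys f"
    using keys_mult[of f "monomial u"] by auto
  show "(\<lambda>m. m + u) ` Poly_Mapping.keys f \<subseteq> Poly_Mapping.keys (f * monomial u)"
    by (auto simp: in_keys_iff monomial_def lookup_times_single)
qed

lemma polys_on_closed_mult:
  assumes "upward A \<subseteq> A" "f \<in> polys_on A"
  shows "c * f \<in> polys_on A"
proof -
  have "m \<in> A" if m: "m \<in> Poly_Mapping.keys (c * f)" for m
  proof -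
    obtain a b where "m = a + b" "b \<in> Poly_Mapping.keys f"
      using keys_mult[of c f] m by blast
    then have "b \<in> A" "b mdvd m" using assms by (auto simp: polys_on_def)
    then show ?thesis using assms(1) by (auto simp: upward_def)
  qed
  then show ?thesis by (auto simp: polys_on_def)
qed

lemma subspace_polys_on:
  assumes "upward A \<subseteq> A"
  shows "ideal.subspace (polys_on A :: ('v, 'k::field) mpoly set)"
proof (rule ideal.subspaceI)
  fix x y :: "('v, 'k) mpoly"
  assume "x \<in> polys_on A" "y \<in> polys_on A"
  then show "x + y \<in> polys_on A" using keys_add[of x y] by (auto simp: polys_on_def)
qed (use polys_on_closed_mult[OF assms] in \<open>auto simp: polys_on_def\<close>)

lemma upwardI: "a \<in> A \<Longrightarrow> a mdvd m \<Longrightarrow> m \<in> upward A"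
  by (auto simp: upward_def)

lemma subset_upward: "A \<subseteq> upward A"
  by (auto intro: upwardI mdvd_refl)

lemma upward_upward [simp]: "upward (upward A) = upward A"
proof
  show "upward (upward A) \<subseteq> upward A"
    using mdvd_trans unfolding upward_def by blast
qed (rule subset_upward)

lemma ideal_gen_monomials:
  "ideal_gen (monomial ` A) = (polys_on (upward A) :: ('v, 'k::field) mpoly set)"
  unfolding ideal_gen_def
proof (rule ideal.span_subspace)
  show "monomial ` A \<subseteq> (polys_on (upward A) :: ('v, 'k) mpoly set)"
    using subset_upward[of A] by auto
  show "ideal.subspace (polys_on (upward A) :: ('v, 'k) mpoly set)"
    by (rule subspace_polys_on) simp
  show "polys_on (upward A) \<subseteq> ideal.span (monomial ` A :: ('v, 'k) mpoly set)"
  proof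
    fix f :: "('v, 'k) mpoly" assume f: "f \<in> polys_on (upward A)"
    show "f \<in> ideal.span (monomial ` A)"
    proof (subst poly_expansion, rule ideal.span_sum)
      fix m assume "m \<in> Poly_Mapping.keys f"
      then obtain a where a: "a \<in> A" "a mdvd m" using f by (auto simp: polys_on_def upward_def)
      have "Poly_Mapping.single m (lk f m) = Poly_Mapping.single (m - a) (lk f m) * (monomial a :: ('v, 'k) mpoly)"
        using minus_plus_mdvd[OF a(2)] by (simp add: monomial_def mult_single)
      then show "Poly_Mapping.single m (lk f m) \<in> ideal.span (monomial ` A)"
        using a(1) by (simp add: ideal.span_base ideal.span_scale)
    qed
  qed
qed

lemma ideal_gen_vars:
  "ideal_gen (var ` V) = (polys_on {m. \<exists>x\<in>V. lk m x \<ge> 1} :: ('v, 'k::field) mpoly set)"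
proof -
  have "var ` V = (monomial ` unit_exp ` V :: ('v, 'k) mpoly set)"
    by (simp add: var_def[abs_def] unit_exp_def[abs_def] image_image)
  then show ?thesis by (simp add: ideal_gen_monomials upward_def unit_exp_mdvd)
qed

text \<open>The product of two monomial ideals corresponds to the sumset of their exponents. A term with
  exponent \<open>a + b\<close> is a scalar multiple of a product of two monomials, and the
  sumset is again upward closed because any surplus can be added to the first summand.\<close>

lemma ideal_gen_products:
  assumes A: "upward A \<subseteq> A" and B: "upward B \<subseteq> B"
  shows "ideal_gen {a * b |a b. a \<in> polys_on A \<and> b \<in> polys_on B} =
         (polys_on {a + b |a b. a \<in> A \<and> b \<in> B} :: ('v, 'k::field) mpoly set)"
    (is "ideal_gen ?P = polys_on ?S")
  unfolding ideal_gen_def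
proof (rule ideal.span_subspace)
  show "?P \<subseteq> polys_on ?S"
    using keys_mult unfolding polys_on_def by fast
  have "upward ?S \<subseteq> ?S"
  proof
    fix m assume "m \<in> upward ?S"
    then obtain a b where ab: "a \<in> A" "b \<in> B" "a + b mdvd m" by (auto simp: upward_def)
    have "m = (m - (a + b) + a) + b" using minus_plus_mdvd[OF ab(3)] by (simp add: add.assoc)
    moreover have "m - (a + b) + a \<in> A" using A ab(1) mdvd_add(1) unfolding upward_def by blast
    ultimately show "m \<in> ?S" using ab(2) by blast
  qed
  then show "ideal.subspace (polys_on ?S :: ('v, 'k) mpoly set)" by (rule subspace_polys_on)
  show "polys_on ?S \<subseteq> ideal.span ?P"
  proof
    fix f :: "('v, 'k) mpoly" assume f: "f \<in> polys_on ?S"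
    show "f \<in> ideal.span ?P"
    proof (subst poly_expansion, rule ideal.span_sum)
      fix m assume "m \<in> Poly_Mapping.keys f"
      then obtain a b where a: "a \<in> A" "b \<in> B" "m = a + b" using f by (auto simp: polys_on_def)
      have eq: "Poly_Mapping.single m (lk f m) = Poly_Mapping.single 0 (lk f m) * (monomial a * monomial b)"
        using a by (simp add: monomial_def mult_single)
      moreover have "monomial a * monomial b \<in> ?P"
        using a by (intro CollectI exI[of _ "monomial a"] exI[of _ "monomial b"]) simp
      ultimately show "Poly_Mapping.single m (lk f m) \<in> ideal.span ?P"
        unfolding eq by (intro ideal.span_scale ideal.span_base)
    qed
  qed
qed

section \<open>Orderings with linear quotients\<close>

text \<open>The monomial \<open>c\<close> divided by its greatest common divisor with \<open>a\<close> is the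
  variable \<open>x\<close>.\<close>

definition var_quotient :: "'v \<Rightarrow> ('v \<Rightarrow>\<^sub>0 nat) \<Rightarrow> ('v \<Rightarrow>\<^sub>0 nat) \<Rightarrow> bool" where
  "var_quotient x c a \<longleftrightarrow> lk c x = Suc (lk a x) \<and> (\<forall>z. z \<noteq> x \<longrightarrow> lk c z \<le> lk a z)"

text \<open>The combinatorial form of linear quotients for monomials: each generator of a colon ideal
  is divisible by a variable that also lies in the colon ideal.\<close>

definition linear_order_list :: "('v \<Rightarrow>\<^sub>0 nat) list \<Rightarrow> bool" where
  "linear_order_list us \<longleftrightarrow> distinct us \<and>
     (\<forall>i<length us. \<forall>j<i. \<exists>l<i. \<exists>x. var_quotient x (us ! l) (us ! i) \<and> lk (us ! i) x < lk (us ! j) x)"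

definition linearly_orderable :: "('v \<Rightarrow>\<^sub>0 nat) set \<Rightarrow> bool" where
  "linearly_orderable A \<longleftrightarrow> (\<exists>us. set us = A \<and> linear_order_list us)"

lemma colon_linear_order_list:
  assumes us: "linear_order_list us" and i: "i < length us"
  defines "V \<equiv> {x. \<exists>l<i. var_quotient x (us ! l) (us ! i)}"
  shows "{f. f * monomial (us ! i) \<in> ideal_gen (monomial ` set (take i us))}
       = (ideal_gen (var ` V) :: ('v, 'k::field) mpoly set)"
proof -
  have "m + us ! i \<in> upward (set (take i us)) \<longleftrightarrow> (\<exists>x\<in>V. lk m x \<ge> 1)" for m
  proof
    assume "m + us ! i \<in> upward (set (take i us))"
    then obtain j where j: "j < i" "us ! j mdvd m + us ! i"
      using i by (auto simp: upward_def in_set_conv_nth)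
    then obtain l x where "l < i" "var_quotient x (us ! l) (us ! i)" and x: "lk (us ! i) x < lk (us ! j) x"
      using us i unfolding linear_order_list_def by blast
    then have "x \<in> V" by (auto simp: V_def)
    moreover have "lk m x \<ge> 1" using j(2)[unfolded mdvd_def, rule_format, of x] x by (simp add: lookup_add)
    ultimately show "\<exists>x\<in>V. lk m x \<ge> 1" by blast
  next
    assume "\<exists>x\<in>V. lk m x \<ge> 1"
    then obtain x l where l: "l < i" "var_quotient x (us ! l) (us ! i)" and m: "lk m x \<ge> 1"
      by (auto simp: V_def)
    have "us ! l mdvd m + us ! i"
      unfolding mdvd_def
    proof
      fix z show "lk (us ! l) z \<le> lk (m + us ! i) z"
        using l(2) m by (cases "z = x") (auto simp: var_quotient_def lookup_add intro: trans_le_add2)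
    qed
    moreover have "us ! l \<in> set (take i us)" using l(1) i by (force simp: in_set_conv_nth)
    ultimately show "m + us ! i \<in> upward (set (take i us))" by (auto simp: upward_def)
  qed
  then show ?thesis
    unfolding ideal_gen_monomials ideal_gen_vars polys_on_def keys_times_monomial image_subset_iff
      mem_Collect_eq subset_eq by simp
qed

lemma colon_principal:
  fixes g :: "('v, 'k::field) mpoly"
  assumes "upward A \<subseteq> A"
  shows "colon (polys_on A) (ideal_gen {g}) = {f. f * g \<in> polys_on A}"
proof -
  have span: "ideal_gen {g} = range (\<lambda>k. k * g)"
    unfolding ideal_gen_def by (rule ideal.span_singleton)
  have "(\<forall>h\<in>ideal_gen {g}. f * h \<in> polys_on A) \<longleftrightarrow> f * g \<in> polys_on A" for f
  proof
    assume *: "\<forall>h\<in>ideal_gen {g}. f * h \<in> polys_on A"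
    have "g \<in> ideal_gen {g}" unfolding span by (rule range_eqI[of _ _ 1]) simp
    then show "f * g \<in> polys_on A" using * by blast
  next
    assume *: "f * g \<in> polys_on A"
    have "f * (k * g) \<in> polys_on A" for k
      using polys_on_closed_mult[OF assms *, of k] by (metis mult.left_commute)
    then show "\<forall>h\<in>ideal_gen {g}. f * h \<in> polys_on A" unfolding span by blast
  qed
  then show ?thesis by (simp add: colon_def)
qed

lemma linear_quotientsI:
  assumes A: "linearly_orderable A"
    and min: "\<And>a b. a \<in> A \<Longrightarrow> b \<in> A \<Longrightarrow> a mdvd b \<Longrightarrow> a = b"
  shows "linear_quotients (polys_on (upward A) :: ('v, 'k::field) mpoly set)"
proof -
  obtain us where us: "set us = A" "linear_order_list us"
    using A by (auto simp: linearly_orderable_def)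
  let ?us = "map monomial us :: ('v, 'k) mpoly list"
  have "distinct ?us" using us(2) by (auto simp: linear_order_list_def distinct_map inj_on_def)
  moreover have "minimal_monomial_generators (set ?us) (polys_on (upward A))"
  proof -
    have "ideal_gen B \<noteq> polys_on (upward A)" if B: "B \<subset> set ?us" for B
    proof
      assume *: "ideal_gen B = polys_on (upward A)"
      have "B \<subseteq> monomial ` A" using B us(1) by auto
      then obtain C where C: "C \<subseteq> A" "B = monomial ` C" by (auto simp: subset_image_iff)
      obtain a where a: "a \<in> A" "a \<notin> C" using B C us(1) by (metis psubsetE set_map subsetI subset_antisym)
      have "upward C = upward A" using * by (simp add: C ideal_gen_monomials polys_on_eq_iff)
      then obtain c where "c \<in> C" "c mdvd a" using a(1) subset_upward[of A] by (force simp: upward_def)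
      then show False using min a C(1) by blast
    qed
    then show ?thesis using us(1) by (auto simp: minimal_monomial_generators_def ideal_gen_monomials)
  qed
  moreover have "\<exists>V. colon (ideal_gen (set (take i ?us))) (ideal_gen {?us ! i}) = ideal_gen (var ` V)"
    if "i < length ?us" for i
  proof -
    have "ideal_gen (set (take i ?us)) = (polys_on (upward (set (take i us))) :: ('v, 'k) mpoly set)"
      by (simp add: take_map ideal_gen_monomials)
    then have "colon (ideal_gen (set (take i ?us))) (ideal_gen {?us ! i})
        = {f. f * monomial (us ! i) \<in> ideal_gen (monomial ` set (take i us))}"
      using that by (simp add: colon_principal ideal_gen_monomials)
    then show ?thesis using colon_linear_order_list[OF us(2)] that by auto
  qed
  ultimately show ?thesis unfolding linear_quotients_def by blast
qed

lemma linearly_orderable_trivial: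
  assumes "A \<subseteq> {a}" shows "linearly_orderable A"
proof -
  from assms have "A = {} \<or> A = {a}" by auto
  moreover have "linearly_orderable {}"
    unfolding linearly_orderable_def by (rule exI[of _ "[]"]) (simp add: linear_order_list_def)
  moreover have "linearly_orderable {a}"
    unfolding linearly_orderable_def by (rule exI[of _ "[a]"]) (simp add: linear_order_list_def)
  ultimately show ?thesis by auto
qed

lemma linearly_orderable_shift:
  assumes "linearly_orderable A" shows "linearly_orderable ((\<lambda>a. a + m) ` A)"
proof -
  obtain us where us: "set us = A" "linear_order_list us"
    using assms by (auto simp: linearly_orderable_def)
  have "linear_order_list (map (\<lambda>a. a + m) us)"
    unfolding linear_order_list_def
  proof (intro conjI allI impI)
    show "distinct (map (\<lambda>a. a + m) us)"
      using us(2) by (auto simp: linear_order_list_def distinct_map inj_on_def)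
  next
    fix i j assume ij: "i < length (map (\<lambda>a. a + m) us)" "j < i"
    then obtain l x where "l < i" "var_quotient x (us ! l) (us ! i) \<and> lk (us ! i) x < lk (us ! j) x"
      using us(2) unfolding linear_order_list_def by force
    then show "\<exists>l<i. \<exists>x. var_quotient x (map (\<lambda>a. a + m) us ! l) (map (\<lambda>a. a + m) us ! i) \<and>
        lk (map (\<lambda>a. a + m) us ! i) x < lk (map (\<lambda>a. a + m) us ! j) x"
      using ij by (intro exI[of _ l]) (auto simp: var_quotient_def lookup_add)
  qed
  then show ?thesis using us(1) unfolding linearly_orderable_def by (intro exI[of _ "map (\<lambda>a. a + m) us"]) simp
qed

text \<open>The inductive principle behind both orderings below: the monomials divisible by \<open>y\<close>
  come first. For a later monomial \<open>c\<close>, which does not involve \<open>y\<close>,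
  every monomial divisible by \<open>y\<close> contributes a multiple of
  \<open>y\<close> to the colon ideal, and \<open>y\<close> itself is contributed by
  \<open>y * b\<close> for any \<open>b\<close> in \<open>B\<close> that divides \<open>c\<close>.\<close>

lemma linearly_orderable_split:
  assumes B: "linearly_orderable B" and C: "linearly_orderable C"
    and zero: "\<And>c. c \<in> C \<Longrightarrow> lk c y = 0"
    and below: "\<And>c. c \<in> C \<Longrightarrow> \<exists>b\<in>B. b mdvd c"
  shows "linearly_orderable ((\<lambda>b. b + unit_exp y) ` B \<union> C)"
proof -
  obtain bs where bs: "set bs = (\<lambda>b. b + unit_exp y) ` B" "linear_order_list bs"
    using linearly_orderable_shift[OF B] unfolding linearly_orderable_def by blast
  obtain cs where cs: "set cs = C" "linear_order_list cs"
    using C by (auto simp: linearly_orderable_def)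
  have pos: "lk b y \<ge> 1" if "b \<in> set bs" for b using that bs(1) by (auto simp: lookup_add lookup_unit_exp)
  have "linear_order_list (bs @ cs)"
    unfolding linear_order_list_def
  proof (intro conjI allI impI)
    show "distinct (bs @ cs)" using bs cs pos zero by (fastforce simp: linear_order_list_def)
  next
    fix i j assume ij: "i < length (bs @ cs)" "j < i"
    let ?us = "bs @ cs"
    show "\<exists>l<i. \<exists>x. var_quotient x (?us ! l) (?us ! i) \<and> lk (?us ! i) x < lk (?us ! j) x"
    proof (cases "i < length bs")
      case True
      then obtain l x where "l < i" "var_quotient x (bs ! l) (bs ! i) \<and> lk (bs ! i) x < lk (bs ! j) x"
        using bs(2) ij unfolding linear_order_list_def by blast
      then show ?thesis using True ij by (intro exI[of _ l]) (auto simp: nth_append)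
    next
      case i: False
      have c: "?us ! i \<in> C" using i ij(1) cs(1) by (auto simp: nth_append)
      show ?thesis
      proof (cases "j < length bs")
        case True
        obtain b where b: "b \<in> B" "b mdvd ?us ! i" using below[OF c] by blast
        then have "b + unit_exp y \<in> set bs" using bs(1) by auto
        then obtain l where l: "l < length bs" "bs ! l = b + unit_exp y" by (auto simp: in_set_conv_nth)
        have "lk b y = 0" using b(2) zero[OF c] by (metis mdvd_def le_zero_eq)
        then have "var_quotient y (?us ! l) (?us ! i)"
          using l b(2) zero[OF c] by (auto simp: var_quotient_def nth_append mdvd_def lookup_add lookup_unit_exp)
        moreover have "lk (?us ! i) y < lk (?us ! j) y"
          using zero[OF c] pos[of "bs ! j"] True by (auto simp: nth_append)
        ultimately show ?thesis using l(1) i by (intro exI[of _ l]) auto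
      next
        case j: False
        let ?n = "length bs"
        obtain l x where "l < i - ?n" "var_quotient x (cs ! l) (cs ! (i - ?n)) \<and> lk (cs ! (i - ?n)) x < lk (cs ! (j - ?n)) x"
        proof -
          have "i - ?n < length cs" "j - ?n < i - ?n" using ij i j by auto
          then show thesis using that cs(2) unfolding linear_order_list_def by blast
        qed
        then show ?thesis using i j ij by (intro exI[of _ "l + ?n"]) (auto simp: nth_append)
      qed
    qed
  qed
  then show ?thesis
    unfolding linearly_orderable_def using bs(1) cs(1) by (intro exI[of _ "bs @ cs"]) simp
qed

section \<open>Weighted forests\<close>

definition positive_part :: "('v \<Rightarrow> 'v \<Rightarrow> nat) \<Rightarrow> 'v set set" where
  "positive_part w = {{i, j} |i j. 0 < w i j}"

definition forest_weight :: "('v \<Rightarrow> 'v \<Rightarrow> nat) \<Rightarrow> bool" where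
  "forest_weight w \<longleftrightarrow> (\<forall>i j. w i j = w j i) \<and> (\<forall>i. w i i = 0) \<and> (\<nexists>c. graph_cycle (positive_part w) c)"

text \<open>The exponents of the intersection of the ideals
  \<open>\<langle>x\<^sub>i, x\<^sub>j\<rangle>\<close> raised to the power
  \<open>w i j\<close>. Arbitrary weights are needed because the induction changes the weights
  of single edges, so it leaves the class of constant weights.\<close>

definition weighted_covers :: "('v \<Rightarrow> 'v \<Rightarrow> nat) \<Rightarrow> ('v \<Rightarrow>\<^sub>0 nat) set" where
  "weighted_covers w = {a. \<forall>i j. w i j \<le> lk a i + lk a j}"

text \<open>What remains to be covered after \<open>m\<close> has been put on the vertices. The truncation
  of the subtraction is intended: an edge that is covered with surplus imposes no condition.\<close>

definition reduce_weight :: "('v \<Rightarrow> 'v \<Rightarrow> nat) \<Rightarrow> ('v \<Rightarrow>\<^sub>0 nat) \<Rightarrow> 'v \<Rightarrow> 'v \<Rightarrow> nat" where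
  "reduce_weight w m i j = w i j - lk m i - lk m j"

definition is_path :: "'v set set \<Rightarrow> 'v list \<Rightarrow> bool" where
  "is_path E p \<longleftrightarrow> distinct p \<and> (\<forall>i. Suc i < length p \<longrightarrow> {p ! i, p ! Suc i} \<in> E)"

text \<open>An end vertex of a longest path is a leaf: a neighbour outside the path would prolong it, and
  a further neighbour on the path would close a cycle.\<close>

lemma acyclic_has_leaf:
  fixes E :: "'v::finite set set"
  assumes E: "simple_graph E" "\<nexists>c. graph_cycle E c" and ne: "E \<noteq> {}"
  obtains x y where "{x, y} \<in> E" "x \<noteq> y" "\<And>z. {x, z} \<in> E \<Longrightarrow> z = y"
proof -
  obtain e where e: "e \<in> E" using ne by blast
  then have "card e = 2" using E(1) by (auto simp: simple_graph_def)
  then obtain u v where uv: "e = {u, v}" "u \<noteq> v" by (auto simp: card_2_iff)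
  have "is_path E [u, v]" using e uv by (auto simp: is_path_def)
  moreover have "length p \<le> card (UNIV :: 'v set)" if "is_path E p" for p
    using that by (metis card_mono distinct_card finite_class.finite_UNIV is_path_def subset_UNIV)
  ultimately obtain p where p: "is_path E p" and max: "\<And>q. is_path E q \<Longrightarrow> length q \<le> length p"
    using ex_has_greatest_nat[of "is_path E" "[u, v]" length "Suc (card (UNIV :: 'v set))"]
    by (metis le_imp_less_Suc)
  have len: "2 \<le> length p" using max[OF \<open>is_path E [u, v]\<close>] by simp
  then obtain x y r where pr: "p = x # y # r"
    by (metis One_nat_def Suc_le_length_iff numeral_2_eq_2)
  have xy: "{x, y} \<in> E" using p unfolding is_path_def pr by (metis length_Cons nth_Cons_0 nth_Cons_Suc Suc_less_eq zero_less_Suc)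
  have "x \<noteq> y" using p by (simp add: is_path_def pr)
  have "z = y" if z: "{x, z} \<in> E" for z
  proof (rule ccontr)
    assume zy: "z \<noteq> y"
    have zx: "z \<noteq> x" using z E(1) unfolding simple_graph_def by (metis card_2_iff insert_absorb2 is_singletonI is_singleton_def doubleton_eq_iff)
    show False
    proof (cases "z \<in> set p")
      case False
      have "is_path E (z # p)"
        unfolding is_path_def
      proof (intro conjI allI impI)
        show "distinct (z # p)" using False p by (simp add: is_path_def)
        fix i assume "Suc i < length (z # p)"
        then show "{(z # p) ! i, (z # p) ! Suc i} \<in> E"
          using p z by (cases i) (auto simp: is_path_def pr insert_commute)
      qed
      then show False using max[of "z # p"] by simp
    next
      case True
      then obtain k where k: "k < length p" "p ! k = z" by (auto simp: in_set_conv_nth)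
      have k2: "2 \<le> k" using k zx zy pr by (cases k; cases "k - 1") auto
      \<comment> \<open>The initial segment of the path up to \<open>z\<close> closes up through the edge \<open>{x, z}\<close>.\<close>
      let ?c = "take (Suc k) p"
      have lc: "length ?c = Suc k" using k by simp
      have "graph_cycle E ?c"
        unfolding graph_cycle_def
      proof (intro conjI allI impI)
        show "3 \<le> length ?c" using lc k2 by simp
        show "distinct ?c" using p by (simp add: is_path_def)
        fix i assume i: "i < length ?c"
        show "{?c ! i, ?c ! (Suc i mod length ?c)} \<in> E"
        proof (cases "i = k")
          case True
          then have "?c ! i = z" using k by simp
          moreover have "?c ! (Suc i mod length ?c) = x" using True lc by (simp add: pr)
          ultimately show ?thesis using z by (simp add: insert_commute)
        next
          case False
          then have "Suc i < Suc k" using i lc by simp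
          then show ?thesis using p k lc by (simp add: is_path_def)
        qed
      qed
      then show False using E(2) by blast
    qed
  qed
  then show thesis using that xy \<open>x \<noteq> y\<close> by blast
qed

lemma graph_cycle_mono: "graph_cycle E c \<Longrightarrow> E \<subseteq> E' \<Longrightarrow> graph_cycle E' c"
  by (auto simp: graph_cycle_def)

text \<open>Induction on the number of edges: remove the edge of a leaf, colour the rest, and give the
  leaf the colour opposite to that of its neighbour, which affects no other edge.\<close>

lemma acyclic_two_colourable:
  fixes E :: "'v::finite set set"
  assumes "simple_graph E" "\<nexists>c. graph_cycle E c"
  shows "\<exists>A. \<forall>i j. {i, j} \<in> E \<longrightarrow> (i \<in> A \<longleftrightarrow> j \<notin> A)"
proof -
  have "finite E" by (rule finite_subset[OF subset_UNIV]) simp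
  then show ?thesis using assms
  proof (induction E rule: finite_psubset_induct)
    case (psubset E)
    show ?case
    proof (cases "E = {}")
      case False
      then obtain x y where xy: "{x, y} \<in> E" "x \<noteq> y" "\<And>z. {x, z} \<in> E \<Longrightarrow> z = y"
        using acyclic_has_leaf[OF psubset.prems] by metis
      let ?F = "E - {{x, y}}"
      have "?F \<subset> E" using xy by blast
      moreover have "simple_graph ?F" using psubset.prems by (simp add: simple_graph_def)
      moreover have "\<nexists>c. graph_cycle ?F c" using psubset.prems graph_cycle_mono[of ?F _ E] by blast
      ultimately obtain A where A: "\<And>i j. {i, j} \<in> ?F \<Longrightarrow> (i \<in> A \<longleftrightarrow> j \<notin> A)"
        using psubset.IH by metis
      let ?A = "if y \<in> A then A - {x} else insert x A"
      have "(i \<in> ?A \<longleftrightarrow> j \<notin> ?A)" if ij: "{i, j} \<in> E" for i j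
      proof (cases "i = x \<or> j = x")
        case True
        then have "{i, j} = {x, y}" using xy(3)[of i] xy(3)[of j] ij by (auto simp: insert_commute)
        then show ?thesis using xy(2) by (auto simp: doubleton_eq_iff)
      next
        case False
        then have "{i, j} \<in> ?F" using ij by auto
        then show ?thesis using A False by auto
      qed
      then show ?thesis by blast
    qed simp
  qed
qed

lemma in_positive_part: "\<forall>i j. w i j = w j i \<Longrightarrow> {i, j} \<in> positive_part w \<longleftrightarrow> 0 < w i j"
  by (auto simp: positive_part_def doubleton_eq_iff)

lemma forest_weight_leaf:
  fixes w :: "'v::finite \<Rightarrow> 'v \<Rightarrow> nat"
  assumes w: "forest_weight w" and "w u v > 0"
  obtains x y where "w x y > 0" "x \<noteq> y" "\<And>z. w x z > 0 \<Longrightarrow> z = y"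
proof -
  have sym: "\<forall>i j. w i j = w j i" and diag: "\<forall>i. w i i = 0" using w by (auto simp: forest_weight_def)
  have "card e = 2" if "e \<in> positive_part w" for e
  proof -
    obtain i j where "e = {i, j}" "0 < w i j" using \<open>e \<in> positive_part w\<close> by (auto simp: positive_part_def)
    moreover from this have "i \<noteq> j" using diag by auto
    ultimately show ?thesis by simp
  qed
  then have simple: "simple_graph (positive_part w)" by (simp add: simple_graph_def)
  have acyclic: "\<nexists>c. graph_cycle (positive_part w) c" using w by (simp add: forest_weight_def)
  have ne: "positive_part w \<noteq> {}" using assms(2) by (auto simp: positive_part_def)
  obtain x y where "{x, y} \<in> positive_part w" "x \<noteq> y" "\<And>z. {x, z} \<in> positive_part w \<Longrightarrow> z = y"
    using acyclic_has_leaf[OF simple acyclic ne] by metis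
  then show thesis using that unfolding in_positive_part[OF sym] by blast
qed

lemma forest_weight_reduce: "forest_weight w \<Longrightarrow> forest_weight (reduce_weight w m)"
proof -
  assume w: "forest_weight w"
  have "positive_part (reduce_weight w m) \<subseteq> positive_part w"
    by (auto simp: positive_part_def reduce_weight_def) (metis zero_less_diff less_nat_zero_code neq0_conv zero_diff)
  then have "\<nexists>c. graph_cycle (positive_part (reduce_weight w m)) c"
    using w graph_cycle_mono unfolding forest_weight_def by blast
  moreover have "reduce_weight w m i j = reduce_weight w m j i" "reduce_weight w m i i = 0" for i j
    using w by (simp_all add: forest_weight_def reduce_weight_def)
  ultimately show ?thesis unfolding forest_weight_def by blast
qed

lemma weighted_covers_reduce:
  "a + m \<in> weighted_covers w \<longleftrightarrow> a \<in> weighted_covers (reduce_weight w m)"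
proof -
  have "w i j \<le> lk (a + m) i + lk (a + m) j \<longleftrightarrow> reduce_weight w m i j \<le> lk a i + lk a j" for i j
    by (auto simp: reduce_weight_def lookup_add)
  then show ?thesis by (simp add: weighted_covers_def)
qed

lemma weighted_covers_mdvd: "a \<in> weighted_covers w \<Longrightarrow> a mdvd b \<Longrightarrow> b \<in> weighted_covers w"
  unfolding weighted_covers_def mdvd_def by (blast intro: order_trans add_mono)

text \<open>The cheapest way to cover all edges at \<open>y\<close> without using \<open>y\<close>
  itself.\<close>

definition nbr_weights :: "('v::finite \<Rightarrow> 'v \<Rightarrow> nat) \<Rightarrow> 'v \<Rightarrow> ('v \<Rightarrow>\<^sub>0 nat)" where
  "nbr_weights w y = Abs_poly_mapping (w y)"

lemma lookup_nbr_weights [simp]: "lk (nbr_weights w y) z = w y z"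
  by (simp add: nbr_weights_def)

lemma nbr_weights_mdvd:
  assumes "a \<in> weighted_covers w" "lk a y = 0"
  shows "nbr_weights w y mdvd a"
  unfolding mdvd_def
proof
  fix z
  have "w y z \<le> lk a y + lk a z" using assms(1) by (simp add: weighted_covers_def)
  then show "lk (nbr_weights w y) z \<le> lk a z" using assms(2) by simp
qed

subsection \<open>Covers of a fixed degree\<close>

definition exp_degree :: "('v::finite \<Rightarrow>\<^sub>0 nat) \<Rightarrow> nat" where
  "exp_degree a = (\<Sum>x\<in>UNIV. lk a x)"

lemma exp_degree_add [simp]: "exp_degree (a + b) = exp_degree a + exp_degree b"
  by (simp add: exp_degree_def lookup_add sum.distrib)

lemma exp_degree_unit_exp [simp]: "exp_degree (unit_exp x) = 1"
  by (simp add: exp_degree_def lookup_unit_exp)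

lemma exp_degree_0_iff [simp]: "exp_degree a = 0 \<longleftrightarrow> a = 0"
  by (auto simp: exp_degree_def intro: poly_mapping_eqI)

text \<open>The support is confined to \<open>X\<close> because, once covers avoiding \<open>y\<close>
  are considered, \<open>y\<close> has to be excluded in the rest of the induction.\<close>

definition covers_of_degree :: "'v::finite set \<Rightarrow> ('v \<Rightarrow> 'v \<Rightarrow> nat) \<Rightarrow> nat \<Rightarrow> ('v \<Rightarrow>\<^sub>0 nat) set" where
  "covers_of_degree X w n = {a \<in> weighted_covers w. Poly_Mapping.keys a \<subseteq> X \<and> exp_degree a = n}"

lemma keys_add_exp: "Poly_Mapping.keys (a + b :: 'v \<Rightarrow>\<^sub>0 nat) = Poly_Mapping.keys a \<union> Poly_Mapping.keys b"
  by (auto simp: in_keys_iff lookup_add)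

lemma keys_unit_exp [simp]: "Poly_Mapping.keys (unit_exp x) = {x}"
  by (simp add: unit_exp_def)

text \<open>If the cover \<open>c\<close> avoids \<open>y\<close>, then lowering it at a leaf
  \<open>x\<close> attached to \<open>y\<close> violates at most the condition of the edge
  between \<open>x\<close> and \<open>y\<close>, and that by one; the reduced weight asks for one less
  there.\<close>

lemma leaf_cover_reduce:
  assumes c: "c \<in> weighted_covers w" "lk c y = 0" and sym: "\<forall>i j. w i j = w j i"
    and cx: "lk c x > 0" and leaf: "\<And>z. w x z > 0 \<Longrightarrow> z = y"
  shows "c - unit_exp x \<in> weighted_covers (reduce_weight w (unit_exp y))"
  unfolding weighted_covers_def
proof (intro CollectI allI)
  fix i j
  have "x \<noteq> y" using cx c(2) by auto
  have "w i j \<le> lk c i + lk c j" using c(1) by (simp add: weighted_covers_def)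
  moreover have "w i j = 0" if "i = x" "j \<noteq> y" using leaf that by force
  moreover have "w i j = 0" if "j = x" "i \<noteq> y" using leaf sym that by force
  ultimately show "reduce_weight w (unit_exp y) i j \<le> lk (c - unit_exp x) i + lk (c - unit_exp x) j"
    using cx \<open>x \<noteq> y\<close> by (auto simp: reduce_weight_def lookup_minus lookup_unit_exp)
qed

text \<open>A cover that uses \<open>y\<close> is \<open>y\<close> times a cover for the reduced weight;
  one that avoids \<open>y\<close> has at least the weights of the edges at \<open>y\<close>
  on its neighbours, and after subtracting these \<open>y\<close> has become isolated.\<close>

lemma covers_of_degree_split:
  fixes w :: "'v::finite \<Rightarrow> 'v \<Rightarrow> nat"
  assumes y: "y \<in> X" and n: "n > 0"
  defines "m \<equiv> nbr_weights w y"
  shows "covers_of_degree X w n =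
     (\<lambda>b. b + unit_exp y) ` covers_of_degree X (reduce_weight w (unit_exp y)) (n - 1) \<union>
     (\<lambda>b. b + m) ` (if Poly_Mapping.keys m \<subseteq> X \<and> exp_degree m \<le> n
                    then covers_of_degree (X - {y}) (reduce_weight w m) (n - exp_degree m) else {})"
    (is "?T = ?B \<union> ?C")
proof
  show "?T \<subseteq> ?B \<union> ?C"
  proof
    fix a assume a: "a \<in> ?T"
    then have aw: "a \<in> weighted_covers w" "Poly_Mapping.keys a \<subseteq> X" "exp_degree a = n"
      by (auto simp: covers_of_degree_def)
    show "a \<in> ?B \<union> ?C"
    proof (cases "lk a y = 0")
      case False
      then have a': "a - unit_exp y + unit_exp y = a"
        by (intro minus_plus_mdvd) (simp add: unit_exp_mdvd)
      then have "a - unit_exp y \<in> weighted_covers (reduce_weight w (unit_exp y))"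
        by (metis aw(1) weighted_covers_reduce)
      moreover have "exp_degree (a - unit_exp y) = n - 1"
        using aw(3) a' by (metis add_diff_cancel_right' exp_degree_add exp_degree_unit_exp)
      moreover have "Poly_Mapping.keys (a - unit_exp y) \<subseteq> X" using aw(2) a' by (metis Un_subset_iff keys_add_exp)
      ultimately have "a - unit_exp y \<in> covers_of_degree X (reduce_weight w (unit_exp y)) (n - 1)"
        by (simp add: covers_of_degree_def)
      then show ?thesis using a' by (metis UnI1 image_eqI)
    next
      case True
      have a': "a - m + m = a"
        unfolding m_def by (intro minus_plus_mdvd nbr_weights_mdvd aw True)
      then have "a - m \<in> weighted_covers (reduce_weight w m)" by (metis aw(1) weighted_covers_reduce)
      moreover have d: "exp_degree (a - m) + exp_degree m = n" using aw(3) a' by (metis exp_degree_add)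
      moreover have k: "Poly_Mapping.keys (a - m) \<subseteq> X" "Poly_Mapping.keys m \<subseteq> X"
        using aw(2) a' by (metis Un_subset_iff keys_add_exp)+
      moreover have "y \<notin> Poly_Mapping.keys (a - m)" using True by (simp add: in_keys_iff lookup_minus)
      ultimately have "a - m \<in> covers_of_degree (X - {y}) (reduce_weight w m) (n - exp_degree m)"
        by (auto simp: covers_of_degree_def)
      moreover have "exp_degree m \<le> n" using d by simp
      ultimately have "a \<in> ?C" using a' k(2) by (simp add: rev_image_eqI)
      then show ?thesis ..
    qed
  qed
  show "?B \<union> ?C \<subseteq> ?T"
    using y n by (auto simp: covers_of_degree_def keys_add_exp weighted_covers_reduce split: if_splits)
qed

text \<open>The generators of a single graded component can be ordered with linear quotients. They are
  split at a neighbour \<open>y\<close> of a leaf, or at any vertex when no positive weights are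
  left. The split principle applies because a cover avoiding \<open>y\<close> can be lowered by
  one at some vertex and still covers the weight reduced at \<open>y\<close>; this produces a
  divisor of the required degree \<open>n - 1\<close>.\<close>

lemma covers_of_degree_linearly_orderable:
  fixes w :: "'v::finite \<Rightarrow> 'v \<Rightarrow> nat"
  assumes "forest_weight w" "\<And>i j. w i j > 0 \<Longrightarrow> i \<in> X"
  shows "linearly_orderable (covers_of_degree X w n)"
  using assms
proof (induction "n + card X" arbitrary: n X w rule: less_induct)
  case less
  have sym: "\<forall>i j. w i j = w j i" and diag: "\<forall>i. w i i = 0" using less.prems(1) by (auto simp: forest_weight_def)
  show ?case
  proof (cases "n = 0 \<or> X = {}")
    case True
    then have "covers_of_degree X w n \<subseteq> {0}" by (auto simp: covers_of_degree_def)
    then show ?thesis by (rule linearly_orderable_trivial)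
  next
    case False
    then have n: "n > 0" "X \<noteq> {}" by auto
    obtain y where y: "y \<in> X"
      and red: "\<And>c. c \<in> covers_of_degree X w n \<Longrightarrow> lk c y = 0 \<Longrightarrow>
        \<exists>x. lk c x > 0 \<and> c - unit_exp x \<in> weighted_covers (reduce_weight w (unit_exp y))"
    proof (cases "\<exists>u v. w u v > 0")
      case True
      then obtain x y where xy: "w x y > 0" "x \<noteq> y" "\<And>z. w x z > 0 \<Longrightarrow> z = y"
        using forest_weight_leaf[OF less.prems(1)] by blast
      show thesis
      proof (rule that)
        show "y \<in> X" using less.prems(2) xy(1) sym by metis
        fix c assume c: "c \<in> covers_of_degree X w n" "lk c y = 0"
        then have cw: "c \<in> weighted_covers w" by (simp add: covers_of_degree_def)
        then have "w x y \<le> lk c x + lk c y" by (simp add: weighted_covers_def)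
        then have "lk c x > 0" using xy(1) c(2) by linarith
        then show "\<exists>x. lk c x > 0 \<and> c - unit_exp x \<in> weighted_covers (reduce_weight w (unit_exp y))"
          using leaf_cover_reduce[OF cw c(2) sym _ xy(3)] by blast
      qed
    next
      case w0: False
      obtain y where "y \<in> X" using n by blast
      then show thesis
      proof (rule that)
        fix c assume c: "c \<in> covers_of_degree X w n" "lk c y = 0"
        then have "c \<noteq> 0" using n by (auto simp: covers_of_degree_def exp_degree_def)
        then obtain x where "lk c x > 0" by (metis lookup_zero neq0_conv poly_mapping_eqI)
        moreover have "c - unit_exp x \<in> weighted_covers (reduce_weight w (unit_exp y))"
          using w0 by (simp add: weighted_covers_def reduce_weight_def)
        ultimately show "\<exists>x. lk c x > 0 \<and> c - unit_exp x \<in> weighted_covers (reduce_weight w (unit_exp y))"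
          by blast
      qed
    qed
    define m where "m = nbr_weights w y"
    let ?B = "covers_of_degree X (reduce_weight w (unit_exp y)) (n - 1)"
    let ?C = "covers_of_degree (X - {y}) (reduce_weight w m) (n - exp_degree m)"
    let ?C' = "(\<lambda>b. b + m) ` (if Poly_Mapping.keys m \<subseteq> X \<and> exp_degree m \<le> n then ?C else {})"
    note split = covers_of_degree_split[OF y n(1), of w, folded m_def]
    have my: "lk m y = 0" using diag by (simp add: m_def)
    have "linearly_orderable ?B"
    proof (rule less.hyps)
      show "n - 1 + card X < n + card X" using n by simp
      show "forest_weight (reduce_weight w (unit_exp y))" by (rule forest_weight_reduce) fact
      show "\<And>i j. 0 < reduce_weight w (unit_exp y) i j \<Longrightarrow> i \<in> X"
        using less.prems(2) unfolding reduce_weight_def by (metis diff_0_eq_0 less_nat_zero_code neq0_conv)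
    qed
    moreover have "linearly_orderable ?C"
    proof (rule less.hyps)
      have "card (X - {y}) < card X" using y by (intro psubset_card_mono) auto
      then show "n - exp_degree m + card (X - {y}) < n + card X" by linarith
      show "forest_weight (reduce_weight w m)" by (rule forest_weight_reduce) fact
      fix i j assume ij: "0 < reduce_weight w m i j"
      then have "0 < w i j" by (simp add: reduce_weight_def)
      moreover have "i \<noteq> y" using ij by (auto simp: reduce_weight_def m_def)
      ultimately show "i \<in> X - {y}" using less.prems(2) by blast
    qed
    then have "linearly_orderable ?C'"
      using linearly_orderable_trivial[of "{}"] by (auto intro: linearly_orderable_shift)
    ultimately show ?thesis
      unfolding split
    proof (rule linearly_orderable_split)
      fix c assume c: "c \<in> ?C'"
      then show cy: "lk c y = 0" using my by (auto simp: covers_of_degree_def lookup_add in_keys_iff split: if_splits)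
      have cT: "c \<in> covers_of_degree X w n" using c split by blast
      obtain x where x: "lk c x > 0" "c - unit_exp x \<in> weighted_covers (reduce_weight w (unit_exp y))"
        using red[OF cT cy] by blast
      have c': "c - unit_exp x + unit_exp x = c" using x(1) by (intro minus_plus_mdvd) (simp add: unit_exp_mdvd)
      have "exp_degree (c - unit_exp x) = n - 1"
        using cT c' by (metis (mono_tags, lifting) add_diff_cancel_right' covers_of_degree_def exp_degree_add exp_degree_unit_exp mem_Collect_eq)
      moreover have "Poly_Mapping.keys (c - unit_exp x) \<subseteq> X"
        using cT c' by (metis (mono_tags, lifting) Un_subset_iff keys_add_exp covers_of_degree_def mem_Collect_eq)
      ultimately have "c - unit_exp x \<in> ?B" using x(2) by (simp add: covers_of_degree_def)
      then show "\<exists>b\<in>?B. b mdvd c" using c' by (metis mdvd_add(2))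
    qed
  qed
qed

subsection \<open>Minimal covers\<close>

definition minimal_covers :: "('v::finite \<Rightarrow> 'v \<Rightarrow> nat) \<Rightarrow> ('v \<Rightarrow>\<^sub>0 nat) set" where
  "minimal_covers w = {a \<in> weighted_covers w. \<forall>b\<in>weighted_covers w. b mdvd a \<longrightarrow> b = a}"

lemma minimal_cover_below:
  assumes "a \<in> weighted_covers w"
  shows "\<exists>b\<in>minimal_covers w. b mdvd a"
proof -
  let ?S = "\<lambda>b. b \<in> weighted_covers w \<and> b mdvd a"
  obtain b where b: "?S b" "\<And>c. ?S c \<Longrightarrow> exp_degree b \<le> exp_degree c"
    using ex_has_least_nat[of ?S a exp_degree] assms by auto
  have "c = b" if c: "c \<in> weighted_covers w" "c mdvd b" for c
  proof -
    have "exp_degree b \<le> exp_degree c" using b c mdvd_trans by blast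
    moreover have "exp_degree (b - c) + exp_degree c = exp_degree b"
      using minus_plus_mdvd[OF c(2)] by (metis exp_degree_add)
    ultimately have "b - c = 0" by (metis exp_degree_0_iff add_le_same_cancel2 le_zero_eq)
    then show ?thesis using minus_plus_mdvd[OF c(2)] by simp
  qed
  then show ?thesis using b(1) by (auto simp: minimal_covers_def)
qed

lemma upward_minimal_covers: "upward (minimal_covers w) = weighted_covers w"
  using minimal_cover_below weighted_covers_mdvd unfolding upward_def
  by (fastforce simp: minimal_covers_def)

text \<open>Otherwise the value at \<open>x\<close> could be lowered by one.\<close>

lemma minimal_cover_tight:
  assumes a: "a \<in> minimal_covers w" and x: "lk a x > 0" and sym: "\<forall>i j. w i j = w j i" and diag: "\<forall>i. w i i = 0"
  shows "\<exists>z. z \<noteq> x \<and> lk a x + lk a z = w x z"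
proof (rule ccontr)
  assume no: "\<not> ?thesis"
  have aw: "w i j \<le> lk a i + lk a j" for i j using a by (simp add: minimal_covers_def weighted_covers_def)
  then have slack: "w x z < lk a x + lk a z" if "z \<noteq> x" for z using no that by (metis le_neq_implies_less)
  have "w i j \<le> lk (a - unit_exp x) i + lk (a - unit_exp x) j" for i j
    using aw[of i j] slack[of j] slack[of i] sym diag
    by (cases "i = j"; cases "i = x"; cases "j = x") (auto simp: lookup_minus lookup_unit_exp)
  then have "a - unit_exp x \<in> weighted_covers w" by (simp add: weighted_covers_def)
  moreover have "a - unit_exp x + unit_exp x = a" using x by (intro minus_plus_mdvd) (simp add: unit_exp_mdvd)
  then have "a - unit_exp x mdvd a" by (metis mdvd_add(2))
  ultimately have "a - unit_exp x = a" using a by (auto simp: minimal_covers_def)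
  then have "lk (a - unit_exp x) x = lk a x" by simp
  then show False using x by (simp add: lookup_minus lookup_unit_exp)
qed

lemma minimal_cover_isolated:
  assumes a: "a \<in> minimal_covers (reduce_weight w (nbr_weights w y))"
    and sym: "\<forall>i j. w i j = w j i" and diag: "\<forall>i. w i i = 0"
  shows "lk a y = 0"
proof (rule ccontr)
  let ?w = "reduce_weight w (nbr_weights w y)"
  have rsym: "\<forall>i j. ?w i j = ?w j i" and rdiag: "\<forall>i. ?w i i = 0"
    using sym diag by (simp_all add: reduce_weight_def add.commute)
  assume "lk a y \<noteq> 0"
  then obtain z where z: "lk a y + lk a z = ?w y z"
    using minimal_cover_tight[OF a _ rsym rdiag, of y] by blast
  moreover have "?w y z = 0" by (simp add: reduce_weight_def)
  ultimately show False using \<open>lk a y \<noteq> 0\<close> by simp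
qed

text \<open>The splitting also respects minimality provided that \<open>y\<close> has a leaf neighbour
  \<open>x\<close>. The only danger is that a minimal cover using \<open>y\<close> has a divisor
  among the covers avoiding \<open>y\<close>. Such a divisor is at least \<open>w x y\<close> at
  \<open>x\<close>. The edge to \<open>y\<close> is the only edge at \<open>x\<close>, and once
  \<open>y\<close> has been used it asks for at most \<open>w x y - 1\<close>, so a minimal cover
  for the reduced weight stays below \<open>w x y\<close> at \<open>x\<close>.\<close>

lemma minimal_covers_split:
  assumes sym: "\<forall>i j. w i j = w j i" and diag: "\<forall>i. w i i = 0"
    and xy: "w x y > 0" "x \<noteq> y" "\<And>z. w x z > 0 \<Longrightarrow> z = y"
  defines "m \<equiv> nbr_weights w y"
  shows "minimal_covers w =
     (\<lambda>b. b + unit_exp y) ` minimal_covers (reduce_weight w (unit_exp y)) \<union>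
     (\<lambda>b. b + m) ` minimal_covers (reduce_weight w m)"
    (is "_ = ?B \<union> ?C")
proof
  have shift: "a \<in> minimal_covers (reduce_weight w u)" if "a + u \<in> minimal_covers w" for a u
    using that weighted_covers_reduce[of _ u w] unfolding minimal_covers_def
    by (auto) (metis add_right_cancel mdvd_add_cancel)
  show "minimal_covers w \<subseteq> ?B \<union> ?C"
  proof
    fix a assume a: "a \<in> minimal_covers w"
    then have aw: "a \<in> weighted_covers w" by (simp add: minimal_covers_def)
    have "m mdvd a \<or> unit_exp y mdvd a"
      using nbr_weights_mdvd[OF aw, of y] by (cases "lk a y = 0") (auto simp: unit_exp_mdvd m_def)
    then obtain u where u: "u = unit_exp y \<or> u = m" "a - u + u = a" using minus_plus_mdvd by blast
    then have "a - u \<in> minimal_covers (reduce_weight w u)" using shift[of "a - u" u] a by simp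
    then show "a \<in> ?B \<union> ?C" using u by (metis UnI1 UnI2 image_eqI)
  qed
  show "?B \<union> ?C \<subseteq> minimal_covers w"
  proof (intro Un_least image_subsetI)
    fix a assume a: "a \<in> minimal_covers (reduce_weight w (unit_exp y))"
    let ?w = "reduce_weight w (unit_exp y)"
    have aw: "a + unit_exp y \<in> weighted_covers w"
      using a by (simp add: minimal_covers_def weighted_covers_reduce)
    have rsym: "\<forall>i j. ?w i j = ?w j i" and rdiag: "\<forall>i. ?w i i = 0"
      using sym diag by (simp_all add: reduce_weight_def add.commute)
    have "lk a x < w x y"
    proof (cases "lk a x = 0")
      case False
      then obtain z where z: "lk a x + lk a z = ?w x z"
        using minimal_cover_tight[OF a _ rsym rdiag, of x] by blast
      then have "z = y" using False xy(3)[of z] by (auto simp: reduce_weight_def)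
      then show ?thesis using z xy(1) by (auto simp: reduce_weight_def lookup_unit_exp)
    qed (use xy(1) in simp)
    moreover have "b = a + unit_exp y" if b: "b \<in> weighted_covers w" "b mdvd a + unit_exp y" for b
    proof -
      have "lk b x \<le> lk (a + unit_exp y) x" using b(2) by (simp only: mdvd_def)
      then have "lk b x \<le> lk a x" using xy(2) by (simp add: lookup_add lookup_unit_exp)
      moreover have "w x y \<le> lk b x + lk b y" using b(1) by (simp add: weighted_covers_def)
      ultimately have "lk b y \<ge> 1" using \<open>lk a x < w x y\<close> by linarith
      then have b': "b - unit_exp y + unit_exp y = b" by (intro minus_plus_mdvd) (simp add: unit_exp_mdvd)
      then have "b - unit_exp y \<in> weighted_covers ?w" "b - unit_exp y mdvd a"
        using b by (metis weighted_covers_reduce, metis mdvd_add_cancel)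
      then have "b - unit_exp y = a" using a by (auto simp: minimal_covers_def)
      then show ?thesis using b' by simp
    qed
    ultimately show "a + unit_exp y \<in> minimal_covers w" using aw by (auto simp: minimal_covers_def)
  next
    fix a assume a: "a \<in> minimal_covers (reduce_weight w m)"
    let ?w = "reduce_weight w m"
    have aw: "a + m \<in> weighted_covers w"
      using a by (simp add: minimal_covers_def weighted_covers_reduce)
    have "lk a y = 0" using minimal_cover_isolated[OF a[unfolded m_def] sym diag] .
    have "b = a + m" if b: "b \<in> weighted_covers w" "b mdvd a + m" for b
    proof -
      have "lk b y \<le> lk (a + m) y" using b(2) by (simp add: mdvd_def)
      then have "lk b y = 0" using \<open>lk a y = 0\<close> diag by (simp add: lookup_add m_def)
      then have b': "b - m + m = b" unfolding m_def by (intro minus_plus_mdvd nbr_weights_mdvd b(1))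
      then have "b - m \<in> weighted_covers ?w" "b - m mdvd a"
        using b by (metis weighted_covers_reduce, metis mdvd_add_cancel)
      then have "b - m = a" using a by (auto simp: minimal_covers_def)
      then show ?thesis using b' by simp
    qed
    then show "a + m \<in> minimal_covers w" using aw by (auto simp: minimal_covers_def)
  qed
qed

text \<open>Induction on the total weight, splitting at the neighbour of a leaf. The divisor
  required by the split principle exists because every cover is a cover for the reduced weight
  and hence lies above a minimal one.\<close>

lemma minimal_covers_linearly_orderable:
  fixes w :: "'v::finite \<Rightarrow> 'v \<Rightarrow> nat"
  assumes "forest_weight w"
  shows "linearly_orderable (minimal_covers w)"
  using assms
proof (induction "\<Sum>i\<in>UNIV. \<Sum>j\<in>UNIV. w i j" arbitrary: w rule: less_induct)
  case less
  have sym: "\<forall>i j. w i j = w j i" and diag: "\<forall>i. w i i = 0" using less.prems(1) by (auto simp: forest_weight_def)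
  show ?case
  proof (cases "\<exists>u v. w u v > 0")
    case False
    then have "a \<in> weighted_covers w" for a by (simp add: weighted_covers_def)
    moreover have "0 mdvd a" for a by (simp add: mdvd_def)
    ultimately have "minimal_covers w \<subseteq> {0}" unfolding minimal_covers_def by blast
    then show ?thesis by (rule linearly_orderable_trivial)
  next
    case True
    then obtain x y where xy: "w x y > 0" "x \<noteq> y" "\<And>z. w x z > 0 \<Longrightarrow> z = y"
      using forest_weight_leaf[OF less.prems(1)] by blast
    define m where "m = nbr_weights w y"
    have split: "minimal_covers w =
        (\<lambda>b. b + unit_exp y) ` minimal_covers (reduce_weight w (unit_exp y)) \<union>
        (\<lambda>b. b + m) ` minimal_covers (reduce_weight w m)"
      unfolding m_def by (rule minimal_covers_split[OF sym diag xy(1,2)]) (rule xy(3))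
    have IH: "linearly_orderable (minimal_covers (reduce_weight w u))" if "reduce_weight w u x y < w x y" for u
    proof (rule less.hyps)
      show "forest_weight (reduce_weight w u)" by (rule forest_weight_reduce) fact
      have le: "reduce_weight w u i j \<le> w i j" for i j by (simp add: reduce_weight_def)
      show "(\<Sum>i\<in>UNIV. \<Sum>j\<in>UNIV. reduce_weight w u i j) < (\<Sum>i\<in>UNIV. \<Sum>j\<in>UNIV. w i j)"
        by (intro sum_strict_mono_ex1 ballI bexI[of _ x] sum_mono le bexI[of _ y] that UNIV_I finite_class.finite_UNIV)
    qed
    have "linearly_orderable (minimal_covers (reduce_weight w (unit_exp y)))"
      using xy(1,2) by (intro IH) (simp add: reduce_weight_def lookup_unit_exp)
    moreover have "linearly_orderable ((\<lambda>b. b + m) ` minimal_covers (reduce_weight w m))"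
      using xy(1) sym by (intro linearly_orderable_shift IH) (simp add: reduce_weight_def m_def)
    ultimately show ?thesis
    proof (subst split, rule linearly_orderable_split)
      fix c assume c: "c \<in> (\<lambda>b. b + m) ` minimal_covers (reduce_weight w m)"
      then obtain a where a: "a \<in> minimal_covers (reduce_weight w m)" "c = a + m" by blast
      have "lk a y = 0" using minimal_cover_isolated[OF a(1)[unfolded m_def] sym diag] .
      then show "lk c y = 0" using a(2) diag by (simp add: lookup_add m_def)
      have "c \<in> weighted_covers w" using c split by (auto simp: minimal_covers_def weighted_covers_reduce)
      then have "c + unit_exp y \<in> weighted_covers w" by (rule weighted_covers_mdvd) simp
      then have "c \<in> weighted_covers (reduce_weight w (unit_exp y))" by (simp add: weighted_covers_reduce)
      then show "\<exists>b\<in>minimal_covers (reduce_weight w (unit_exp y)). b mdvd c" by (rule minimal_cover_below)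
    qed
  qed
qed

section \<open>Powers of the cover ideal\<close>

definition edge_weight :: "'v set set \<Rightarrow> nat \<Rightarrow> 'v \<Rightarrow> 'v \<Rightarrow> nat" where
  "edge_weight E k i j = (if {i, j} \<in> E then k else 0)"

lemma forest_edge_weight:
  assumes "tree_graph E"
  shows "forest_weight (edge_weight E k)"
proof -
  have "{i} \<notin> E" for i
    using assms by (force simp: tree_graph_def simple_graph_def)
  then have "edge_weight E k i i = 0" for i by (simp add: edge_weight_def)
  moreover have "edge_weight E k i j = edge_weight E k j i" for i j
    by (simp add: edge_weight_def insert_commute)
  moreover have "positive_part (edge_weight E k) \<subseteq> E"
    by (auto simp: positive_part_def edge_weight_def split: if_splits)
  then have "\<nexists>c. graph_cycle (positive_part (edge_weight E k)) c"
    using assms graph_cycle_mono unfolding tree_graph_def by blast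
  ultimately show ?thesis by (simp add: forest_weight_def)
qed

lemma in_edge_weight_covers:
  "a \<in> weighted_covers (edge_weight E k) \<longleftrightarrow> (\<forall>i j. {i, j} \<in> E \<longrightarrow> k \<le> lk a i + lk a j)"
  by (auto simp: weighted_covers_def edge_weight_def)

lemma vertex_cover_ideal_eq:
  assumes "simple_graph E"
  shows "vertex_cover_ideal E = (polys_on (weighted_covers (edge_weight E 1)) :: ('v, 'k::field) mpoly set)"
proof -
  have "m \<in> weighted_covers (edge_weight E 1) \<longleftrightarrow> (\<forall>e\<in>E. \<exists>x\<in>e. 1 \<le> lk m x)" for m
  proof
    assume m: "m \<in> weighted_covers (edge_weight E 1)"
    show "\<forall>e\<in>E. \<exists>x\<in>e. 1 \<le> lk m x"
    proof
      fix e assume e: "e \<in> E"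
      then obtain i j where ij: "e = {i, j}" using assms by (auto simp: simple_graph_def card_2_iff)
      then have "1 \<le> lk m i + lk m j" using m e by (simp only: in_edge_weight_covers)
      then have "1 \<le> lk m i \<or> 1 \<le> lk m j" by linarith
      then show "\<exists>x\<in>e. 1 \<le> lk m x" using ij by blast
    qed
  next
    assume *: "\<forall>e\<in>E. \<exists>x\<in>e. 1 \<le> lk m x"
    show "m \<in> weighted_covers (edge_weight E 1)"
      unfolding in_edge_weight_covers
    proof (intro allI impI)
      fix i j assume "{i, j} \<in> E"
      then have "\<exists>x\<in>{i, j}. 1 \<le> lk m x" using * by (rule bspec[rotated])
      then show "1 \<le> lk m i + lk m j" by auto
    qed
  qed
  then have "weighted_covers (edge_weight E 1) = {m. \<forall>e\<in>E. \<exists>x\<in>e. 1 \<le> lk m x}" by blast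
  then show ?thesis
    unfolding vertex_cover_ideal_def ideal_gen_vars polys_on_def by blast
qed

text \<open>On a bipartite graph a cover of weight \<open>k + 1\<close> splits off a vertex cover. It
  consists of the vertices of one colour with value at least 1 and those of the other colour
  with value at least \<open>k + 1\<close>. If an edge has value 0 at its first end, it has value
  at least \<open>k + 1\<close> at the second; if both ends are chosen, the two values sum to
  at least \<open>k + 2\<close>, so removing one from each leaves \<open>k\<close>. This is why
  ordinary and symbolic powers agree here.\<close>

lemma weighted_covers_sum:
  fixes E :: "'v::finite set set"
  assumes A: "\<And>i j. {i, j} \<in> E \<Longrightarrow> (i \<in> A \<longleftrightarrow> j \<notin> A)"
  shows "weighted_covers (edge_weight E (Suc k)) =
    {a + b |a b. a \<in> weighted_covers (edge_weight E 1) \<and> b \<in> weighted_covers (edge_weight E k)}"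
proof (intro set_eqI iffI)
  fix c assume c: "c \<in> weighted_covers (edge_weight E (Suc k))"
  define C where "C = {i. (i \<in> A \<and> 1 \<le> lk c i) \<or> (i \<notin> A \<and> Suc k \<le> lk c i)}"
  define a where "a = Abs_poly_mapping (\<lambda>i. if i \<in> C then 1 else (0::nat))"
  have a: "lk a i = (if i \<in> C then 1 else 0)" for i by (simp add: a_def)
  have "a mdvd c" unfolding mdvd_def a C_def by auto
  then have eq: "c = a + (c - a)" using minus_plus_mdvd by (metis add.commute)
  have "1 \<le> lk a i + lk a j \<and> k \<le> lk (c - a) i + lk (c - a) j" if ij: "{i, j} \<in> E" "i \<in> A" for i j
  proof -
    have "Suc k \<le> lk c i + lk c j" using c ij(1) by (simp only: in_edge_weight_covers)
    moreover have "j \<notin> A" using A ij by blast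
    ultimately show ?thesis using ij(2) by (auto simp: a C_def lookup_minus)
  qed
  then have both: "1 \<le> lk a i + lk a j \<and> k \<le> lk (c - a) i + lk (c - a) j" if "{i, j} \<in> E" for i j
    using A that by (metis add.commute insert_commute)
  have "a \<in> weighted_covers (edge_weight E 1)" "c - a \<in> weighted_covers (edge_weight E k)"
    unfolding in_edge_weight_covers using both by blast+
  then show "c \<in> {a + b |a b. a \<in> weighted_covers (edge_weight E 1) \<and> b \<in> weighted_covers (edge_weight E k)}"
    using eq by blast
next
  fix c assume "c \<in> {a + b |a b. a \<in> weighted_covers (edge_weight E 1) \<and> b \<in> weighted_covers (edge_weight E k)}"
  then obtain a b where "c = a + b" "a \<in> weighted_covers (edge_weight E 1)" "b \<in> weighted_covers (edge_weight E k)"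
    by blast
  then have "Suc k \<le> lk c i + lk c j" if "{i, j} \<in> E" for i j
    using that unfolding in_edge_weight_covers by (fastforce simp: lookup_add)
  then show "c \<in> weighted_covers (edge_weight E (Suc k))"
    unfolding in_edge_weight_covers by blast
qed

lemma upward_weighted_covers: "upward (weighted_covers w) \<subseteq> weighted_covers w"
  using weighted_covers_mdvd by (auto simp: upward_def)

lemma ideal_power_vertex_cover_ideal:
  fixes E :: "'v::finite set set"
  assumes "tree_graph E"
  shows "ideal_power (vertex_cover_ideal E) k =
    (polys_on (weighted_covers (edge_weight E k)) :: ('v, 'k::field) mpoly set)"
proof -
  have E: "simple_graph E" "\<nexists>c. graph_cycle E c" using assms by (simp_all add: tree_graph_def)
  obtain A where A: "\<And>i j. {i, j} \<in> E \<Longrightarrow> (i \<in> A \<longleftrightarrow> j \<notin> A)"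
    using acyclic_two_colourable[OF E] by blast
  show ?thesis
  proof (induction k)
    case 0
    have "weighted_covers (edge_weight E 0) = UNIV" by (auto simp: weighted_covers_def edge_weight_def)
    then show ?case by (simp add: polys_on_def)
  next
    case (Suc k)
    show ?case
      unfolding ideal_power.simps Suc
      unfolding vertex_cover_ideal_eq[OF E(1)]
        ideal_gen_products[OF upward_weighted_covers upward_weighted_covers]
      by (subst weighted_covers_sum[of E A k, OF A]) auto
  qed
qed

lemma ideal_gen_polys_on: "ideal_gen (polys_on A) = (ideal_gen (monomial ` A) :: ('v, 'k::field) mpoly set)"
proof
  have "polys_on A \<subseteq> (ideal_gen (monomial ` A) :: ('v, 'k) mpoly set)"
    unfolding ideal_gen_monomials polys_on_mono by (rule subset_upward)
  then show "ideal_gen (polys_on A) \<subseteq> (ideal_gen (monomial ` A) :: ('v, 'k) mpoly set)"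
    unfolding ideal_gen_def by (rule ideal.span_minimal) simp
  show "(ideal_gen (monomial ` A) :: ('v, 'k) mpoly set) \<subseteq> ideal_gen (polys_on A)"
    unfolding ideal_gen_def by (rule ideal.span_mono) auto
qed

lemma homogeneous_eq_polys_on:
  "homogeneous j = (polys_on {m. int (exp_degree m) = j} :: ('v::finite, 'k::field) mpoly set)"
  by (auto simp: homogeneous_def polys_on_def exp_degree_def)

lemma truncated_cover_ideal:
  fixes w :: "'v::finite \<Rightarrow> 'v \<Rightarrow> nat" and j :: int
  assumes w: "forest_weight w"
  obtains us where "linear_order_list us" "\<And>u. u \<in> set us \<Longrightarrow> int (exp_degree u) = j"
    "ideal_gen (polys_on (weighted_covers w) \<inter> homogeneous j) =
      (ideal_gen (monomial ` set us) :: ('v, 'k::field) mpoly set)"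
proof -
  let ?A = "{a \<in> weighted_covers w. int (exp_degree a) = j}"
  have "linearly_orderable ?A"
  proof (cases "j < 0")
    case True
    then have "?A = {}" by auto
    then show ?thesis by (metis empty_subsetI linearly_orderable_trivial)
  next
    case False
    then have "?A = covers_of_degree UNIV w (nat j)" by (auto simp: covers_of_degree_def)
    then show ?thesis using covers_of_degree_linearly_orderable[OF w, of UNIV] by auto
  qed
  then obtain us where us: "set us = ?A" "linear_order_list us" unfolding linearly_orderable_def by blast
  have "polys_on (weighted_covers w) \<inter> homogeneous j = (polys_on ?A :: ('v, 'k) mpoly set)"
    unfolding homogeneous_eq_polys_on by (auto simp: polys_on_def)
  then have "ideal_gen (polys_on (weighted_covers w) \<inter> homogeneous j) =
      (ideal_gen (monomial ` set us) :: ('v, 'k) mpoly set)"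
    by (simp add: ideal_gen_polys_on us(1))
  then show thesis using that us by blast
qed

lemma graded_ideal_polys_on: "graded_ideal (polys_on (upward A) :: ('v::finite, 'k::field) mpoly set)"
  unfolding graded_ideal_def
proof (intro exI conjI)
  show "polys_on (upward A) = (ideal_gen (monomial ` A) :: ('v, 'k) mpoly set)"
    by (simp add: ideal_gen_monomials)
  show "(monomial ` A :: ('v, 'k) mpoly set) \<subseteq> (\<Union>j. homogeneous j)"
    by (auto simp: homogeneous_eq_polys_on)
qed

section \<open>Linear maps between free modules\<close>

lemma lookup_free_scale [simp]: "lk (free_scale c v) t = c * lk v t"
  by (simp add: free_scale_def map.rep_eq when_def)

interpretation free: module "free_scale :: 'r::comm_ring_1 \<Rightarrow> (nat \<Rightarrow>\<^sub>0 'r) \<Rightarrow> (nat \<Rightarrow>\<^sub>0 'r)"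
  by unfold_locales (simp_all add: poly_mapping_eq_iff fun_eq_iff lookup_add distrib_left distrib_right mult.assoc)

lemma free_module_iff: "v \<in> free_module n \<longleftrightarrow> (\<forall>t\<ge>n. lk v t = 0)"
proof -
  have "Poly_Mapping.keys v \<subseteq> {..<n} \<longleftrightarrow> (\<forall>t. lk v t \<noteq> 0 \<longrightarrow> t < n)"
    unfolding subset_eq in_keys_iff lessThan_iff Ball_def by blast
  then show ?thesis unfolding free_module_def by (auto simp: not_less[symmetric])
qed

lemma subspace_free_module: "free.subspace (free_module n)"
  by (rule free.subspaceI) (auto simp: free_module_iff lookup_add)

lemma single_in_free_module: "t < n \<Longrightarrow> Poly_Mapping.single t c \<in> free_module n"
  by (auto simp: free_module_iff lookup_single when_def)

lemma free_module_mono: "n \<le> n' \<Longrightarrow> v \<in> free_module n \<Longrightarrow> v \<in> free_module n'"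
  by (auto simp: free_module_iff)

text \<open>\<open>lin_ext\<close> sums over the support of its argument; summing over a common finite
  superset makes linearity visible.\<close>

lemma lin_ext_superset:
  assumes "finite S" "Poly_Mapping.keys v \<subseteq> S"
  shows "lin_ext free_scale b v = (\<Sum>t\<in>S. free_scale (lk v t) (b t))"
  unfolding lin_ext_def
  by (rule sum.mono_neutral_left) (use assms in \<open>auto simp: in_keys_iff\<close>)

lemma lin_ext_free_module:
  assumes "v \<in> free_module n"
  shows "lin_ext free_scale b v = (\<Sum>t<n. free_scale (lk v t) (b t))"
  by (rule lin_ext_superset) (use assms in \<open>auto simp: free_module_def\<close>)

lemma module_hom_lin_ext: "module_hom free_scale free_scale (lin_ext free_scale b)"
proof
  fix v w :: "nat \<Rightarrow>\<^sub>0 'a" and c :: 'a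
  let ?S = "Poly_Mapping.keys v \<union> Poly_Mapping.keys w"
  have "lin_ext free_scale b u = (\<Sum>t\<in>?S. free_scale (lk u t) (b t))"
    if "Poly_Mapping.keys u \<subseteq> ?S" for u
    by (rule lin_ext_superset[OF _ that]) simp
  moreover have "Poly_Mapping.keys (v + w) \<subseteq> ?S" "Poly_Mapping.keys (free_scale c v) \<subseteq> ?S"
    using keys_add[of v w] by (auto simp: in_keys_iff)
  ultimately show "lin_ext free_scale b (v + w) = lin_ext free_scale b v + lin_ext free_scale b w"
    "lin_ext free_scale b (free_scale c v) = free_scale c (lin_ext free_scale b v)"
    by (simp_all add: lookup_add free.scale_left_distrib sum.distrib free.scale_sum_right)
qed

lemmas lin_ext_add = module_hom.add[OF module_hom_lin_ext]
  and lin_ext_scale = module_hom.scale[OF module_hom_lin_ext]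
  and lin_ext_diff = module_hom.diff[OF module_hom_lin_ext]
  and lin_ext_zero [simp] = module_hom.zero[OF module_hom_lin_ext]
  and lin_ext_sum = module_hom.sum[OF module_hom_lin_ext]

lemma lin_ext_single [simp]: "lin_ext free_scale b (Poly_Mapping.single t c) = free_scale c (b t)"
  by (simp add: lin_ext_superset[of "{t}"])

lemma lookup_lin_ext:
  "v \<in> free_module n \<Longrightarrow> lk (lin_ext free_scale b v) s = (\<Sum>t<n. lk v t * lk (b t) s)"
  by (simp add: lin_ext_free_module lookup_sum)

lemma lin_ext_cong:
  assumes "v \<in> free_module n" "\<And>t. t < n \<Longrightarrow> b t = b' t"
  shows "lin_ext free_scale b v = lin_ext free_scale b' v"
  using assms by (simp add: lin_ext_free_module)

lemma lin_ext_in_free_module: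
  assumes "v \<in> free_module n" "\<And>t. t < n \<Longrightarrow> b t \<in> free_module n'"
  shows "lin_ext free_scale b v \<in> free_module n'"
  unfolding lin_ext_free_module[OF assms(1)]
  by (intro free.subspace_sum free.subspace_scale subspace_free_module) (use assms(2) in auto)

lemma free_module_expansion:
  assumes "v \<in> free_module n"
  shows "v = (\<Sum>t<n. Poly_Mapping.single t (lk v t))"
  by (rule poly_mapping_eqI)
     (use assms in \<open>auto simp: lookup_sum lookup_single when_def sum.delta free_module_iff not_less\<close>)

lemma lin_ext_comp:
  assumes "v \<in> free_module n"
  shows "lin_ext free_scale b (lin_ext free_scale c v) = lin_ext free_scale (\<lambda>t. lin_ext free_scale b (c t)) v"
  using assms by (simp add: lin_ext_free_module[of v] lin_ext_sum lin_ext_scale)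

lemma lin_ext_image_eq_span:
  "lin_ext free_scale b ` free_module n = free.span (b ` {..<n})"
proof
  show "lin_ext free_scale b ` free_module n \<subseteq> free.span (b ` {..<n})"
  proof (rule image_subsetI)
    fix v :: "nat \<Rightarrow>\<^sub>0 'a" assume v: "v \<in> free_module n"
    show "lin_ext free_scale b v \<in> free.span (b ` {..<n})"
      unfolding lin_ext_free_module[OF v]
      by (rule free.span_sum, rule free.span_scale, rule free.span_base) simp
  qed
  have "b t \<in> lin_ext free_scale b ` free_module n" if "t < n" for t
    by (rule image_eqI[of _ _ "Poly_Mapping.single t 1"]) (use that in \<open>auto intro: single_in_free_module\<close>)
  then show "free.span (b ` {..<n}) \<subseteq> lin_ext free_scale b ` free_module n"
    by (intro free.span_minimal module_hom.subspace_image[OF module_hom_lin_ext] subspace_free_module) auto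
qed

lemma lin_ext_nth_image:
  assumes "n \<le> length gs"
  shows "lin_ext free_scale ((!) gs) ` free_module n = free.span (set (take n gs))"
  unfolding lin_ext_image_eq_span using nth_image[OF assms] by (simp add: lessThan_atLeast0)

section \<open>Homogeneous components\<close>

text \<open>The homogeneous component of degree \<open>j\<close>.\<close>

definition hcomp :: "int \<Rightarrow> ('v::finite, 'k::field) mpoly \<Rightarrow> ('v, 'k) mpoly" where
  "hcomp j f = (\<Sum>m | m \<in> Poly_Mapping.keys f \<and> int (exp_degree m) = j. Poly_Mapping.single m (lk f m))"

lemma lookup_hcomp: "lk (hcomp j f) m = (lk f m when int (exp_degree m) = j)"
  by (auto simp: hcomp_def lookup_sum lookup_single when_def sum.delta in_keys_iff)

lemma in_homogeneous_iff: "f \<in> homogeneous j \<longleftrightarrow> (\<forall>m. lk f m \<noteq> 0 \<longrightarrow> int (exp_degree m) = j)"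
  by (auto simp: homogeneous_eq_polys_on polys_on_def in_keys_iff subset_eq)

lemma zero_homogeneous [simp]: "0 \<in> homogeneous j"
  by (simp add: in_homogeneous_iff)

lemma homogeneous_diff: "f \<in> homogeneous j \<Longrightarrow> g \<in> homogeneous j \<Longrightarrow> f - g \<in> homogeneous j"
  by (auto simp: in_homogeneous_iff lookup_minus) (metis diff_0_right)

lemma homogeneous_mult:
  assumes "f \<in> homogeneous i" "g \<in> homogeneous j"
  shows "f * g \<in> homogeneous (i + j)"
proof -
  have "int (exp_degree m) = i + j" if m: "m \<in> Poly_Mapping.keys (f * g)" for m
  proof -
    obtain a b where "m = a + b" "a \<in> Poly_Mapping.keys f" "b \<in> Poly_Mapping.keys g"
      using keys_mult[of f g] m by blast
    then show ?thesis using assms by (auto simp: in_homogeneous_iff in_keys_iff)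
  qed
  then show ?thesis by (auto simp: in_homogeneous_iff in_keys_iff)
qed

lemma hcomp_homogeneous [simp]: "hcomp j f \<in> homogeneous j"
  by (auto simp: in_homogeneous_iff lookup_hcomp)

lemma hcomp_ident: "f \<in> homogeneous j \<Longrightarrow> hcomp j f = f"
  by (rule poly_mapping_eqI) (auto simp: in_homogeneous_iff lookup_hcomp when_def)

lemma hcomp_add: "hcomp j (f + g) = hcomp j f + hcomp j g"
  by (rule poly_mapping_eqI) (auto simp: lookup_hcomp lookup_add when_def)

lemma hcomp_zero [simp]: "hcomp j 0 = 0"
  by (rule poly_mapping_eqI) (auto simp: lookup_hcomp when_def)

lemma hcomp_sum: "hcomp j (sum f I) = (\<Sum>i\<in>I. hcomp j (f i))"
  by (induction I rule: infinite_finite_induct) (auto simp: hcomp_add)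

lemma hcomp_mult:
  assumes g: "g \<in> homogeneous e"
  shows "hcomp (j + e) (f * g) = hcomp j f * g"
proof -
  define r where "r = f - hcomp j f"
  have r: "lk r m = 0" if "int (exp_degree m) = j" for m
    using that by (simp add: r_def lookup_minus lookup_hcomp)
  have "hcomp (j + e) (r * g) = 0"
  proof (rule poly_mapping_eqI, rule ccontr)
    fix m assume "lk (hcomp (j + e) (r * g)) m \<noteq> lk 0 m"
    then have m: "int (exp_degree m) = j + e" "m \<in> Poly_Mapping.keys (r * g)"
      by (auto simp: lookup_hcomp in_keys_iff)
    then obtain a b where ab: "m = a + b" "a \<in> Poly_Mapping.keys r" "b \<in> Poly_Mapping.keys g"
      using keys_mult[of r g] by blast
    have "int (exp_degree b) = e" using g ab(3) by (auto simp: in_homogeneous_iff in_keys_iff)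
    then have "int (exp_degree a) = j" using m(1) ab(1) by simp
    then show False using r ab(2) by (simp add: in_keys_iff)
  qed
  moreover have "f * g = hcomp j f * g + r * g" by (simp add: r_def algebra_simps)
  moreover have "hcomp (j + e) (hcomp j f * g) = hcomp j f * g"
    by (intro hcomp_ident homogeneous_mult g) simp
  ultimately show ?thesis by (simp add: hcomp_add)
qed

text \<open>Here the basis vector with index \<open>t\<close> has degree \<open>dg t\<close>, so a
  homogeneous vector of degree \<open>j\<close> has coordinates of degree
  \<open>j - dg t\<close>.\<close>

definition graded_vec :: "(nat \<Rightarrow> int) \<Rightarrow> int \<Rightarrow> (nat \<Rightarrow>\<^sub>0 ('v::finite, 'k::field) mpoly) \<Rightarrow> bool" where
  "graded_vec dg j v \<longleftrightarrow> (\<forall>t. lk v t \<in> homogeneous (j - dg t))"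

definition vec_comp :: "(nat \<Rightarrow> int) \<Rightarrow> int \<Rightarrow> (nat \<Rightarrow>\<^sub>0 ('v::finite, 'k::field) mpoly) \<Rightarrow> (nat \<Rightarrow>\<^sub>0 ('v, 'k) mpoly)" where
  "vec_comp dg j v = (\<Sum>t\<in>Poly_Mapping.keys v. Poly_Mapping.single t (hcomp (j - dg t) (lk v t)))"

lemma lookup_vec_comp: "lk (vec_comp dg j v) t = hcomp (j - dg t) (lk v t)"
  by (auto simp: vec_comp_def lookup_sum lookup_single when_def sum.delta in_keys_iff)

lemma vec_comp_zero [simp]: "vec_comp dg j 0 = 0"
  by (simp add: vec_comp_def)

lemma graded_vec_comp: "graded_vec dg j (vec_comp dg j v)"
  by (simp add: graded_vec_def lookup_vec_comp)

lemma vec_comp_free_module: "v \<in> free_module n \<Longrightarrow> vec_comp dg j v \<in> free_module n"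
  by (simp add: free_module_iff lookup_vec_comp)

lemma lin_ext_vec_comp:
  assumes v: "v \<in> free_module n" and b: "\<And>t. t < n \<Longrightarrow> graded_vec dg (dg' t) (b t)"
  shows "lin_ext free_scale b (vec_comp dg' j v) = vec_comp dg j (lin_ext free_scale b v)"
proof (rule poly_mapping_eqI)
  fix s
  have "hcomp (j - dg' t) (lk v t) * lk (b t) s = hcomp (j - dg s) (lk v t * lk (b t) s)" if "t < n" for t
    using hcomp_mult[of "lk (b t) s" "dg' t - dg s" "j - dg' t" "lk v t"] b[OF that]
    by (simp add: graded_vec_def)
  then show "lk (lin_ext free_scale b (vec_comp dg' j v)) s = lk (vec_comp dg j (lin_ext free_scale b v)) s"
    by (simp add: lookup_lin_ext[OF v] lookup_lin_ext[OF vec_comp_free_module[OF v]] lookup_vec_comp hcomp_sum)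
qed

lemma vec_comp_ident: "graded_vec dg j v \<Longrightarrow> vec_comp dg j v = v"
  by (rule poly_mapping_eqI) (simp add: graded_vec_def lookup_vec_comp hcomp_ident)

text \<open>Since the map is graded, the homogeneous component of any preimage is a preimage.\<close>

lemma graded_preimage:
  assumes z: "z \<in> lin_ext free_scale b ` free_module n" "graded_vec dg j z"
    and b: "\<And>t. t < n \<Longrightarrow> graded_vec dg (dg' t) (b t)"
  shows "\<exists>u\<in>free_module n. graded_vec dg' j u \<and> lin_ext free_scale b u = z"
proof -
  obtain u where u: "u \<in> free_module n" "z = lin_ext free_scale b u" using z(1) by blast
  then have "lin_ext free_scale b (vec_comp dg' j u) = z"
    using lin_ext_vec_comp[OF u(1), of dg dg' b j] b vec_comp_ident[OF z(2)] by simp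
  then show ?thesis using vec_comp_free_module[OF u(1)] graded_vec_comp by blast
qed

lemma graded_vec_lin_ext:
  assumes v: "v \<in> free_module n" "graded_vec dg' j v" and b: "\<And>t. t < n \<Longrightarrow> graded_vec dg (dg' t) (b t)"
  shows "graded_vec dg j (lin_ext free_scale b v)"
  using lin_ext_vec_comp[OF v(1), of dg dg' b j] b vec_comp_ident[OF v(2)] graded_vec_comp by metis

lemma graded_vec_diff: "graded_vec dg j u \<Longrightarrow> graded_vec dg j v \<Longrightarrow> graded_vec dg j (u - v)"
  by (simp add: graded_vec_def lookup_minus homogeneous_diff)

section \<open>Linear quotients for submodules of free modules\<close>

type_synonym ('v, 'k) fvec = "nat \<Rightarrow>\<^sub>0 ('v, 'k) mpoly"

text \<open>Linear quotients for the submodule of a free module that is generated by a list.\<close>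

definition variable_quotients :: "('v::finite, 'k::field) fvec list \<Rightarrow> bool" where
  "variable_quotients gs \<longleftrightarrow> (\<forall>i<length gs. \<exists>V.
     {f. free_scale f (gs ! i) \<in> free.span (set (take i gs))} = ideal_gen (var ` V))"

lemma variable_quotients_snoc:
  assumes "variable_quotients gs"
    and "{f. free_scale f g \<in> free.span (set gs)} = ideal_gen (var ` V)"
  shows "variable_quotients (gs @ [g])"
  unfolding variable_quotients_def
proof (intro allI impI)
  fix i assume "i < length (gs @ [g])"
  then consider "i < length gs" | "i = length gs" by force
  then show "\<exists>V. {f. free_scale f ((gs @ [g]) ! i) \<in> free.span (set (take i (gs @ [g])))} = ideal_gen (var ` V)"
  proof cases
    case 1
    then show ?thesis using assms(1) unfolding variable_quotients_def by (auto simp: nth_append)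
  next
    case 2
    then show ?thesis using assms(2) by auto
  qed
qed

lemma var_colon_vars:
  assumes "x \<notin> Y"
  shows "{f. f * var x \<in> ideal_gen (var ` Y)} = (ideal_gen (var ` Y) :: ('v, 'k::field) mpoly set)"
proof -
  have "(\<exists>y\<in>Y. 1 \<le> lk (m + unit_exp x) y) \<longleftrightarrow> (\<exists>y\<in>Y. 1 \<le> lk m y)" for m
    using assms by (auto simp: lookup_add lookup_unit_exp)
  then show ?thesis
    unfolding ideal_gen_vars polys_on_def var_def unit_exp_def[symmetric] mem_Collect_eq
      keys_times_monomial image_subset_iff subset_eq by simp
qed

lemma ideal_gen_insert_var:
  "f \<in> ideal_gen (var ` insert x Y) \<longleftrightarrow> (\<exists>c. f - c * var x \<in> ideal_gen (var ` Y))"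
  unfolding ideal_gen_def by (simp add: ideal.span_breakdown_eq)

text \<open>For a submodule \<open>N\<close> consider the vectors whose coordinates beyond
  \<open>n\<close> vanish; their coordinates at \<open>n\<close> form an ideal. If all these
  leading ideals are generated by variables, then \<open>N\<close> has generators of degree
  one with linear quotients: choose for each \<open>n\<close> and each variable \<open>x\<close> of
  its leading ideal a vector \<open>g\<close> with leading coordinate \<open>x\<close>, and list
  them in this order. A multiple \<open>f * g\<close> is generated by the previous vectors iff
  \<open>f * x\<close> lies in the ideal of the variables \<open>Y\<close> used before at position
  \<open>n\<close>, that is, iff \<open>f\<close> does. This form of the span is carried through an
  inner induction on \<open>Y\<close>.\<close>

lemma variable_quotients_of_leading_ideals:
  fixes N :: "('v::finite, 'k::field) fvec set"
  assumes N: "free.subspace N" and comp: "\<And>v. v \<in> N \<Longrightarrow> vec_comp (\<lambda>_. 0) 1 v \<in> N"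
    and lead: "\<And>n. n < r \<Longrightarrow> \<exists>V. {lk v n |v. v \<in> N \<and> v \<in> free_module (Suc n)} = ideal_gen (var ` V)"
  shows "\<exists>gs. free.span (set gs) = N \<inter> free_module r \<and> variable_quotients gs \<and>
              (\<forall>g\<in>set gs. graded_vec (\<lambda>_. 0) 1 g)"
  using lead
proof (induction r)
  case 0
  have "N \<inter> free_module 0 = {0}"
    using free.subspace_0[OF N] by (auto simp: free_module_def intro: poly_mapping_eqI)
  then show ?case by (intro exI[of _ "[]"]) (simp add: variable_quotients_def)
next
  case (Suc n)
  obtain V where V: "{lk v n |v. v \<in> N \<and> v \<in> free_module (Suc n)} = ideal_gen (var ` V)"
    using Suc.prems[of n] by auto
  let ?M = "\<lambda>Y. {v \<in> N. v \<in> free_module (Suc n) \<and> lk v n \<in> ideal_gen (var ` Y)}"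
  have "finite V" by simp
  moreover have "Y \<subseteq> V \<Longrightarrow> \<exists>gs. free.span (set gs) = ?M Y \<and> variable_quotients gs \<and>
              (\<forall>g\<in>set gs. graded_vec (\<lambda>_. 0) 1 g)" if "finite Y" for Y
    using that
  proof (induction Y rule: finite_induct)
    case empty
    have "v \<in> free_module (Suc n) \<and> lk v n = 0 \<longleftrightarrow> v \<in> free_module n" for v :: "('v, 'k) fvec"
      by (auto simp: free_module_iff) (metis le_SucE le_antisym not_less_eq_eq)
    then have "?M {} = N \<inter> free_module n" by (auto simp: ideal_gen_def)
    then show ?case using Suc.IH Suc.prems by auto
  next
    case (insert x Y)
    then obtain gs where gs: "free.span (set gs) = ?M Y" "variable_quotients gs"
      "\<forall>g\<in>set gs. graded_vec (\<lambda>_. 0) 1 g" by blast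
    have "var x \<in> (ideal_gen (var ` V) :: ('v, 'k) mpoly set)"
      using insert.prems by (auto simp: ideal_gen_def intro: ideal.span_base)
    then have "var x \<in> {lk v n |v. v \<in> N \<and> v \<in> free_module (Suc n)}" unfolding V .
    then obtain h where h: "h \<in> N" "h \<in> free_module (Suc n)" "lk h n = var x" by force
    \<comment> \<open>Passing to the component of degree 1 keeps the leading coordinate, as \<open>x\<close> has degree 1.\<close>
    define g where "g = vec_comp (\<lambda>_. 0) 1 h"
    have var1: "var x \<in> (homogeneous 1 :: ('v, 'k) mpoly set)"
      by (simp add: var_def unit_exp_def[symmetric] homogeneous_eq_polys_on del: One_nat_def)
    have g: "g \<in> N" "g \<in> free_module (Suc n)" "lk g n = var x"
      using comp[OF h(1)] vec_comp_free_module[OF h(2)] h(3)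
      by (simp_all add: g_def lookup_vec_comp hcomp_ident[OF var1])
    have "{f. free_scale f g \<in> free.span (set gs)} = ideal_gen (var ` Y)"
      using var_colon_vars[OF insert.hyps(2), where ?'k = 'k]
      unfolding gs(1) by (auto simp: g free.subspace_scale[OF N] free.subspace_scale[OF subspace_free_module])
    then have "variable_quotients (gs @ [g])" by (rule variable_quotients_snoc[OF gs(2)])
    moreover have "\<forall>g'\<in>set (gs @ [g]). graded_vec (\<lambda>_. 0) 1 g'"
      using gs(3) graded_vec_comp by (auto simp: g_def)
    moreover have "free.span (set (gs @ [g])) = ?M (insert x Y)"
    proof -
      have "v - free_scale c g \<in> N \<longleftrightarrow> v \<in> N" "v - free_scale c g \<in> free_module (Suc n) \<longleftrightarrow> v \<in> free_module (Suc n)"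
        for v c
        using free.subspace_scale[OF N g(1)] free.subspace_scale[OF subspace_free_module g(2)]
          free.subspace_add[OF N, of "v - free_scale c g" "free_scale c g"] free.subspace_diff[OF N, of v "free_scale c g"]
          free.subspace_add[OF subspace_free_module, of "v - free_scale c g" "Suc n" "free_scale c g"]
          free.subspace_diff[OF subspace_free_module, of v "Suc n" "free_scale c g"]
        by auto
      then show ?thesis
        unfolding set_append list.set Un_insert_right Un_empty_right free.span_insert gs(1) ideal_gen_insert_var
        by (auto simp: lookup_minus g(3))
    qed
    ultimately show ?case by blast
  qed
  ultimately obtain gs where gs: "free.span (set gs) = ?M V" "variable_quotients gs"
      "\<forall>g\<in>set gs. graded_vec (\<lambda>_. 0) 1 g" by blast
  have "?M V = N \<inter> free_module (Suc n)" using V by auto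
  then show ?case using gs by auto
qed

text \<open>Linear quotients are inherited by the syzygies, with generators of degree one. The reason is
  that the leading ideal of the syzygies at \<open>n\<close> is by definition the
  colon ideal of the \<open>n\<close>-th generator by the previous ones.\<close>

lemma syzygies_variable_quotients:
  fixes ms :: "('v::finite, 'k::field) fvec list"
  assumes ms: "variable_quotients ms" and deg: "\<And>m. m \<in> set ms \<Longrightarrow> graded_vec (\<lambda>_. 0) e m"
  shows "\<exists>gs. variable_quotients gs \<and> (\<forall>g\<in>set gs. graded_vec (\<lambda>_. 0) 1 g \<and> g \<in> free_module (length ms)) \<and>
     {v \<in> free_module (length ms). lin_ext free_scale ((!) ms) v = 0} =
       lin_ext free_scale ((!) gs) ` free_module (length gs)"
proof -
  let ?L = "lin_ext free_scale ((!) ms)" and ?r = "length ms"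
  define N where "N = {v \<in> free_module ?r. ?L v = 0}"
  have N: "free.subspace N"
    unfolding N_def
    by (rule free.subspaceI)
       (auto simp: lin_ext_add lin_ext_scale intro: free.subspace_add free.subspace_scale free.subspace_0 subspace_free_module)
  have "vec_comp (\<lambda>_. 0) 1 v \<in> N" if "v \<in> N" for v
  proof -
    have v: "v \<in> free_module ?r" "?L v = 0" using that by (simp_all add: N_def)
    have "vec_comp (\<lambda>_. 0) 1 v = vec_comp (\<lambda>_. e) (1 + e) v"
      by (rule poly_mapping_eqI) (simp add: lookup_vec_comp)
    moreover have "?L (vec_comp (\<lambda>_. e) (1 + e) v) = vec_comp (\<lambda>_. 0) (1 + e) (?L v)"
      by (rule lin_ext_vec_comp[OF v(1)]) (use deg in auto)
    ultimately show ?thesis using v by (auto simp: N_def vec_comp_free_module)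
  qed
  moreover have "\<exists>V. {lk v n |v. v \<in> N \<and> v \<in> free_module (Suc n)} = ideal_gen (var ` V)" if n: "n < ?r" for n
  proof -
    have "{lk v n |v. v \<in> N \<and> v \<in> free_module (Suc n)} =
          {f. free_scale f (ms ! n) \<in> free.span (set (take n ms))}" (is "?A = ?B")
    proof (intro set_eqI iffI)
      fix f assume "f \<in> ?A"
      then obtain v where v: "f = lk v n" "?L v = 0" "v \<in> free_module (Suc n)" by (auto simp: N_def)
      let ?u = "Poly_Mapping.single n f - v"
      have "?u \<in> free_module n"
        using v by (auto simp: free_module_iff lookup_minus lookup_single when_def)
      moreover have "?L ?u = free_scale f (ms ! n)" using v by (simp add: lin_ext_diff)
      ultimately show "f \<in> ?B" using lin_ext_nth_image[of n ms] n by (metis image_eqI less_imp_le mem_Collect_eq)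
    next
      fix f assume "f \<in> ?B"
      then have "free_scale f (ms ! n) \<in> ?L ` free_module n" using lin_ext_nth_image[of n ms] n by simp
      then obtain u where u: "u \<in> free_module n" "?L u = free_scale f (ms ! n)" by auto
      let ?v = "Poly_Mapping.single n f - u"
      have "?v \<in> free_module (Suc n)" "lk ?v n = f"
        using u by (auto simp: free_module_iff lookup_minus lookup_single when_def)
      moreover from this have "?v \<in> N" using n u(2) free_module_mono[of "Suc n" ?r ?v]
        by (simp add: N_def lin_ext_diff)
      ultimately show "f \<in> ?A" by (metis (mono_tags, lifting) mem_Collect_eq)
    qed
    then show ?thesis using ms n unfolding variable_quotients_def by auto
  qed
  ultimately obtain gs where gs: "free.span (set gs) = N \<inter> free_module ?r" "variable_quotients gs"
     "\<forall>g\<in>set gs. graded_vec (\<lambda>_. 0) 1 g"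
    using variable_quotients_of_leading_ideals[OF N, of ?r] by blast
  have "N \<inter> free_module ?r = N" by (auto simp: N_def)
  moreover have "free.span (set gs) = lin_ext free_scale ((!) gs) ` free_module (length gs)"
    using lin_ext_nth_image[of "length gs" gs] by simp
  ultimately have "N = lin_ext free_scale ((!) gs) ` free_module (length gs)" using gs(1) by simp
  moreover have "g \<in> free_module ?r" if "g \<in> set gs" for g
    using gs(1) free.span_base[OF that] by (auto simp: N_def)
  ultimately show ?thesis using gs(2,3) unfolding N_def by blast
qed

section \<open>The linear resolution\<close>

lemma module_hom_single0: "module_hom (*) free_scale (\<lambda>p. Poly_Mapping.single (0::nat) p)"
  by unfold_locales (auto intro!: poly_mapping_eqI simp: lookup_single lookup_add when_def algebra_simps)

lemma lin_ext_single0: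
  "lin_ext free_scale (\<lambda>t. Poly_Mapping.single 0 (a t)) v = Poly_Mapping.single (0::nat) (lin_ext (*) a v)"
proof -
  have "free_scale c (Poly_Mapping.single 0 p) = Poly_Mapping.single (0::nat) (c * p)" for c p :: 'a
    by (rule module_hom.scale[OF module_hom_single0, symmetric])
  then show ?thesis by (simp add: lin_ext_def module_hom.sum[OF module_hom_single0])
qed

text \<open>The ideal is regarded as a submodule of the free module of rank one, so that the passage to
  syzygies can start from it.\<close>

lemma variable_quotients_monomials:
  assumes us: "linear_order_list us"
  shows "variable_quotients (map (\<lambda>u. Poly_Mapping.single 0 (monomial u :: ('v::finite, 'k::field) mpoly)) us)"
    (is "variable_quotients ?gs")
  unfolding variable_quotients_def
proof (intro allI impI)
  fix i assume i: "i < length ?gs"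
  have "set (take i ?gs) = Poly_Mapping.single 0 ` monomial ` set (take i us)"
    by (simp add: take_map image_image)
  then have "free.span (set (take i ?gs)) = Poly_Mapping.single 0 ` ideal_gen (monomial ` set (take i us))"
    unfolding ideal_gen_def by (simp only: module_hom.span_image[OF module_hom_single0])
  then have "free_scale f (?gs ! i) \<in> free.span (set (take i ?gs)) \<longleftrightarrow>
      f * monomial (us ! i) \<in> ideal_gen (monomial ` set (take i us))" for f
    using i by (auto simp: module_hom.scale[OF module_hom_single0, symmetric] inj_eq[OF inj_single])
  then show "\<exists>V. {f. free_scale f (?gs ! i) \<in> free.span (set (take i ?gs))} = ideal_gen (var ` V)"
    using colon_linear_order_list[OF us, of i, where ?'k = 'k] i by auto
qed

text \<open>Iterating the passage to syzygies yields a free resolution in which every differential has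
  linear entries, so that all degrees go up by exactly one in each step.\<close>

lemma linear_free_resolution_exists:
  assumes us: "linear_order_list us" and deg: "\<And>u. u \<in> set us \<Longrightarrow> int (exp_degree u) = d"
  shows "\<exists>F. graded_free_resolution (ideal_module (ideal_gen (monomial ` set us) :: ('v::finite, 'k::field) mpoly set)) F \<and>
    (\<forall>i t. fr_degree F i t = d + int i)"
proof -
  let ?I = "ideal_gen (monomial ` set us) :: ('v, 'k) mpoly set"
  define a where "a = (\<lambda>t. monomial (us ! t) :: ('v, 'k) mpoly)"
  define gs0 where "gs0 = map (\<lambda>u. Poly_Mapping.single (0::nat) (monomial u :: ('v, 'k) mpoly)) us"
  \<comment> \<open>The generators given by the monomials have degree \<open>d\<close>; all later ones are syzygies, with linear entries.\<close>
  let ?P = "\<lambda>(n::nat) gs. variable_quotients gs \<and> (\<forall>g\<in>set gs. graded_vec (\<lambda>_. 0) (if n = 0 then d else 1) g) \<and> (n = 0 \<longrightarrow> gs = gs0)"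
  let ?Q = "\<lambda>ms gs. (\<forall>g\<in>set gs. graded_vec (\<lambda>_. 0) 1 g \<and> g \<in> free_module (length ms)) \<and>
     {v \<in> free_module (length ms). lin_ext free_scale ((!) ms) v = 0} =
       lin_ext free_scale ((!) gs) ` free_module (length gs)"
  have mono: "monomial u \<in> (homogeneous d :: ('v, 'k) mpoly set)" if "u \<in> set us" for u
    using deg[OF that] by (simp add: homogeneous_eq_polys_on)
  have "\<exists>G :: nat \<Rightarrow> ('v, 'k) fvec list. \<forall>n. ?P n (G n) \<and> ?Q (G n) (G (Suc n))"
  proof (rule dependent_nat_choice)
    have "variable_quotients gs0" unfolding gs0_def by (rule variable_quotients_monomials[OF us])
    moreover have "\<forall>g\<in>set gs0. graded_vec (\<lambda>_. 0) d g"
      using mono by (auto simp: gs0_def graded_vec_def lookup_single when_def)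
    ultimately show "\<exists>gs. ?P 0 gs" by auto
  next
    fix ms :: "('v, 'k) fvec list" and n assume P: "?P n ms"
    define e where "e = (if n = 0 then d else 1)"
    have "\<And>m. m \<in> set ms \<Longrightarrow> graded_vec (\<lambda>_. 0) e m" using P by (simp add: e_def)
    from syzygies_variable_quotients[OF conjunct1[OF P] this]
    show "\<exists>gs. ?P (Suc n) gs \<and> ?Q ms gs" by auto
  qed
  then obtain G :: "nat \<Rightarrow> ('v, 'k) fvec list" where G: "\<forall>n. ?P n (G n) \<and> ?Q (G n) (G (Suc n))"
    by (rule exE)
  have P: "?P n (G n)" for n by (rule conjunct1[OF spec[OF G]])
  have Q: "?Q (G n) (G (Suc n))" for n by (rule conjunct2[OF spec[OF G]])
  have G0: "G 0 = gs0" using P[of 0] by simp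
  have len0: "length (G 0) = length us" by (simp add: G0 gs0_def)
  have G0_lin: "lin_ext free_scale ((!) (G 0)) v = Poly_Mapping.single 0 (lin_ext (*) a v)"
    if "v \<in> free_module (length us)" for v
    unfolding lin_ext_single0[symmetric]
    by (rule lin_ext_cong[OF that]) (simp add: G0 gs0_def a_def)
  have G0_image: "lin_ext (*) a ` free_module (length us) = ?I"
  proof -
    have "Poly_Mapping.single (0::nat) ` lin_ext (*) a ` free_module (length us) =
        lin_ext free_scale ((!) (G 0)) ` free_module (length us)"
      using G0_lin by (simp add: image_image)
    also have "\<dots> = free.span (set (G 0))" using lin_ext_nth_image[of "length us" "G 0"] len0 by simp
    also have "set (G 0) = Poly_Mapping.single 0 ` monomial ` set us" by (simp add: G0 gs0_def image_image)
    also have "free.span \<dots> = Poly_Mapping.single 0 ` ?I"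
      unfolding ideal_gen_def by (rule module_hom.span_image[OF module_hom_single0])
    finally show ?thesis by (simp add: inj_image_eq_iff)
  qed
  define F where "F = \<lparr> fr_rank = \<lambda>i. length (G i), fr_degree = \<lambda>i t. d + int i,
      fr_diff = \<lambda>i t. G (Suc i) ! t, fr_aug = a \<rparr>"
  have "graded_free_resolution (ideal_module ?I) F"
    unfolding graded_free_resolution_def
  proof (intro conjI allI impI)
    fix t assume "t < fr_rank F 0"
    then have t: "us ! t \<in> set us" using len0 by (simp add: F_def)
    then have "a t \<in> ?I" by (auto simp: a_def ideal_gen_def intro: ideal.span_base)
    then show "fr_aug F t \<in> gm_part (ideal_module ?I) (fr_degree F 0 t)"
      using mono[OF t] by (simp add: F_def ideal_module_def a_def)
  next
    fix i t assume "t < fr_rank F (Suc i)"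
    then have g: "G (Suc i) ! t \<in> set (G (Suc i))" by (simp add: F_def)
    then show "fr_diff F i t \<in> free_module (fr_rank F i)" using Q[of i] by (simp add: F_def)
    fix s show "lk (fr_diff F i t) s \<in> homogeneous (fr_degree F (Suc i) t - fr_degree F i s)"
      using Q[of i] g by (simp add: F_def graded_vec_def)
  next
    show "lin_ext (gm_scale (ideal_module ?I)) (fr_aug F) ` free_module (fr_rank F 0) = gm_carrier (ideal_module ?I)"
      using G0_image len0 by (simp add: F_def ideal_module_def)
  next
    have "{v \<in> free_module (length us). lin_ext (*) a v = 0} =
          {v \<in> free_module (length (G 0)). lin_ext free_scale ((!) (G 0)) v = 0}"
      using G0_lin by (auto simp: len0) (metis lookup_single_eq lookup_zero)
    then show "{v \<in> free_module (fr_rank F 0). lin_ext (gm_scale (ideal_module ?I)) (fr_aug F) v = 0}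
       = lin_ext free_scale (fr_diff F 0) ` free_module (fr_rank F 1)"
      using Q[of 0] len0 by (simp add: F_def ideal_module_def)
  next
    fix i show "{v \<in> free_module (fr_rank F (Suc i)). lin_ext free_scale (fr_diff F i) v = 0}
       = lin_ext free_scale (fr_diff F (Suc i)) ` free_module (fr_rank F (Suc (Suc i)))"
      using Q[of "Suc i"] by (simp add: F_def)
  qed
  then show ?thesis by (intro exI[of _ F]) (simp add: F_def)
qed

section \<open>Comparison of resolutions\<close>

text \<open>Complexes of graded free modules \<open>F\<^sub>0 \<leftarrow> F\<^sub>1 \<leftarrow>
  \<dots>\<close> that are exact from \<open>F\<^sub>1\<close> on. A resolution of an
  ideal is viewed in this way with \<open>F\<^sub>0\<close> the polynomial ring, so that the
  augmentation needs no separate treatment.\<close>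

definition graded_exact ::
    "(nat \<Rightarrow> nat) \<Rightarrow> (nat \<Rightarrow> nat \<Rightarrow> int) \<Rightarrow> (nat \<Rightarrow> nat \<Rightarrow> ('v::finite, 'k::field) fvec) \<Rightarrow> bool" where
  "graded_exact R dg D \<longleftrightarrow>
     (\<forall>i. \<forall>t<R (Suc i). D i t \<in> free_module (R i) \<and> graded_vec (dg i) (dg (Suc i) t) (D i t)) \<and>
     (\<forall>i. {v \<in> free_module (R (Suc i)). lin_ext free_scale (D i) v = 0}
       = lin_ext free_scale (D (Suc i)) ` free_module (R (Suc (Suc i))))"

lemma lin_ext_minus_fun:
  "lin_ext free_scale (\<lambda>t. a t - b t) u = lin_ext free_scale a u - lin_ext free_scale b u"
  by (simp add: lin_ext_def sum_subtractf free.scale_right_diff_distrib)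

lemma lin_ext_basis: "lin_ext free_scale (\<lambda>t. Poly_Mapping.single t 1) u = u"
proof -
  obtain n where "Poly_Mapping.keys u \<subseteq> {..<n}"
    using finite_nat_set_iff_bounded[of "Poly_Mapping.keys u"] by (auto simp: subset_eq)
  then have u: "u \<in> free_module n" by (simp add: free_module_def)
  have "free_scale c (Poly_Mapping.single t 1) = Poly_Mapping.single t c" for c :: 'a and t
    by (rule poly_mapping_eqI) (simp add: lookup_single when_def)
  then show ?thesis using free_module_expansion[OF u] by (simp add: lin_ext_free_module[OF u])
qed

text \<open>The basic step in constructing maps out of a free module: choose homogeneous preimages of
  the images of the basis vectors.\<close>

lemma lift_basis:
  assumes D: "\<And>t. t < n \<Longrightarrow> graded_vec dg (dg' t) (D t)"
    and z: "\<And>t. t < m \<Longrightarrow> z t \<in> lin_ext free_scale D ` free_module n \<and> graded_vec dg (e t) (z t)"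
  shows "\<exists>\<phi>. \<forall>t<m. \<phi> t \<in> free_module n \<and> graded_vec dg' (e t) (\<phi> t) \<and> lin_ext free_scale D (\<phi> t) = z t"
proof -
  have "\<exists>u. t < m \<longrightarrow> u \<in> free_module n \<and> graded_vec dg' (e t) u \<and> lin_ext free_scale D u = z t" for t
  proof (cases "t < m")
    case True
    have "\<exists>u\<in>free_module n. graded_vec dg' (e t) u \<and> lin_ext free_scale D u = z t"
    proof (rule graded_preimage)
      show "z t \<in> lin_ext free_scale D ` free_module n" "graded_vec dg (e t) (z t)" using z[OF True] by simp_all
    qed (rule D)
    then show ?thesis by blast
  qed simp
  then show ?thesis by (rule choice[OF allI])
qed

text \<open>Two such complexes resolving the same submodule of the same free module at the bottom.\<close>

locale two_resolutions =
  fixes R R' :: "nat \<Rightarrow> nat" and dg dg' :: "nat \<Rightarrow> nat \<Rightarrow> int"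
    and D D' :: "nat \<Rightarrow> nat \<Rightarrow> ('v::finite, 'k::field) fvec"
  assumes exact: "graded_exact R dg D" and exact': "graded_exact R' dg' D'"
    and bottom: "R' 0 = R 0" "dg' 0 = dg 0"
      "lin_ext free_scale (D' 0) ` free_module (R' 1) = lin_ext free_scale (D 0) ` free_module (R 1)"
begin

abbreviation (input) lin where "lin \<equiv> lin_ext free_scale"

lemma D_free: "t < R (Suc i) \<Longrightarrow> D i t \<in> free_module (R i)"
  and D_graded: "t < R (Suc i) \<Longrightarrow> graded_vec (dg i) (dg (Suc i) t) (D i t)"
  and D'_free: "t < R' (Suc i) \<Longrightarrow> D' i t \<in> free_module (R' i)"
  and D'_graded: "t < R' (Suc i) \<Longrightarrow> graded_vec (dg' i) (dg' (Suc i) t) (D' i t)"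
  using exact exact' by (auto simp: graded_exact_def)

lemma ker_D: "{v \<in> free_module (R (Suc i)). lin (D i) v = 0} = lin (D (Suc i)) ` free_module (R (Suc (Suc i)))"
  and ker_D': "{v \<in> free_module (R' (Suc i)). lin (D' i) v = 0} = lin (D' (Suc i)) ` free_module (R' (Suc (Suc i)))"
  using exact exact' by (auto simp: graded_exact_def)

lemma D_D: "t < R (Suc (Suc i)) \<Longrightarrow> lin (D i) (D (Suc i) t) = 0"
  using ker_D[of i] single_in_free_module[of t "R (Suc (Suc i))" 1] lin_ext_single[of "D (Suc i)" t 1]
  by (metis (mono_tags, lifting) free.scale_one image_eqI mem_Collect_eq)

lemma D'_D': "t < R' (Suc (Suc i)) \<Longrightarrow> lin (D' i) (D' (Suc i) t) = 0"
  using ker_D'[of i] single_in_free_module[of t "R' (Suc (Suc i))" 1] lin_ext_single[of "D' (Suc i)" t 1]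
  by (metis (mono_tags, lifting) free.scale_one image_eqI mem_Collect_eq)

text \<open>The state at level \<open>i\<close> of the construction of two chain maps
  \<open>\<phi>\<close> and \<open>\<psi>\<close>, in opposite directions, and a homotopy
  \<open>h\<close> from the identity to \<open>\<psi> \<circ> \<phi>\<close>, all given by their
  values on the basis vectors. The last three conditions are what is needed to extend them to
  the next level. In the last of them the contribution of the previous level of the homotopy
  vanishes, because it is evaluated at boundaries.\<close>

definition comparison :: "nat \<Rightarrow> (nat \<Rightarrow> ('v, 'k) fvec) \<Rightarrow> (nat \<Rightarrow> ('v, 'k) fvec) \<Rightarrow> (nat \<Rightarrow> ('v, 'k) fvec) \<Rightarrow> bool" where
  "comparison i \<phi> \<psi> h \<longleftrightarrow>
     (\<forall>t<R i. \<phi> t \<in> free_module (R' i) \<and> graded_vec (dg' i) (dg i t) (\<phi> t)) \<and>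
     (\<forall>t<R' i. \<psi> t \<in> free_module (R i) \<and> graded_vec (dg i) (dg' i t) (\<psi> t)) \<and>
     (\<forall>t<R i. h t \<in> free_module (R (Suc i)) \<and> graded_vec (dg (Suc i)) (dg i t) (h t)) \<and>
     (\<forall>t<R (Suc i). lin \<phi> (D i t) \<in> lin (D' i) ` free_module (R' (Suc i))) \<and>
     (\<forall>t<R' (Suc i). lin \<psi> (D' i t) \<in> lin (D i) ` free_module (R (Suc i))) \<and>
     (\<forall>t<R (Suc i). lin (D i) (lin h (D i t)) = D i t - lin \<psi> (lin \<phi> (D i t)))"

lemma comparison_0: "comparison 0 (\<lambda>t. Poly_Mapping.single t 1) (\<lambda>t. Poly_Mapping.single t 1) (\<lambda>_. 0)"
proof -
  have in_image: "b t \<in> lin b ` free_module n" if "t < n" for t n and b :: "nat \<Rightarrow> ('v, 'k) fvec"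
    unfolding lin_ext_image_eq_span using that by (intro free.span_base) auto
  have "graded_vec g (g t) (Poly_Mapping.single t 1 :: ('v, 'k) fvec)" for g t
    by (auto simp: graded_vec_def lookup_single when_def in_homogeneous_iff lookup_one)
  moreover have "lin (\<lambda>_. 0) v = 0" for v :: "('v, 'k) fvec" by (simp add: lin_ext_def)
  ultimately show ?thesis
    using bottom in_image[of _ "R (Suc 0)" "D 0"] in_image[of _ "R' (Suc 0)" "D' 0"]
    by (auto simp: comparison_def lin_ext_basis single_in_free_module free.subspace_0[OF subspace_free_module]
      graded_vec_def simp del: image_iff)
qed

lemma comparison_step:
  assumes comp: "comparison i \<phi> \<psi> h"
  shows "\<exists>\<phi>' \<psi>' h'. comparison (Suc i) \<phi>' \<psi>' h' \<and>
     (\<forall>u\<in>free_module (R (Suc i)). lin (D (Suc i)) (lin h' u) = u - lin \<psi>' (lin \<phi>' u) - lin h (lin (D i) u))"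
proof -
  have \<phi>: "t < R i \<Longrightarrow> \<phi> t \<in> free_module (R' i)" "t < R i \<Longrightarrow> graded_vec (dg' i) (dg i t) (\<phi> t)"
    and \<psi>: "t < R' i \<Longrightarrow> \<psi> t \<in> free_module (R i)" "t < R' i \<Longrightarrow> graded_vec (dg i) (dg' i t) (\<psi> t)"
    and h: "t < R i \<Longrightarrow> h t \<in> free_module (R (Suc i))" "t < R i \<Longrightarrow> graded_vec (dg (Suc i)) (dg i t) (h t)"
    and \<phi>D: "t < R (Suc i) \<Longrightarrow> lin \<phi> (D i t) \<in> lin (D' i) ` free_module (R' (Suc i))"
    and \<psi>D: "t < R' (Suc i) \<Longrightarrow> lin \<psi> (D' i t) \<in> lin (D i) ` free_module (R (Suc i))"
    and hD: "t < R (Suc i) \<Longrightarrow> lin (D i) (lin h (D i t)) = D i t - lin \<psi> (lin \<phi> (D i t))" for t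
    using comp by (auto simp: comparison_def)
  obtain \<phi>' where \<phi>': "\<forall>t<R (Suc i). \<phi>' t \<in> free_module (R' (Suc i)) \<and>
      graded_vec (dg' (Suc i)) (dg (Suc i) t) (\<phi>' t) \<and> lin (D' i) (\<phi>' t) = lin \<phi> (D i t)"
    using lift_basis[of "R' (Suc i)" "dg' i" "dg' (Suc i)" "D' i" "R (Suc i)" "\<lambda>t. lin \<phi> (D i t)" "dg (Suc i)"]
      D'_graded \<phi>D graded_vec_lin_ext[OF D_free D_graded \<phi>(2)] by blast
  obtain \<psi>' where \<psi>': "\<forall>t<R' (Suc i). \<psi>' t \<in> free_module (R (Suc i)) \<and>
      graded_vec (dg (Suc i)) (dg' (Suc i) t) (\<psi>' t) \<and> lin (D i) (\<psi>' t) = lin \<psi> (D' i t)"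
    using lift_basis[of "R (Suc i)" "dg i" "dg (Suc i)" "D i" "R' (Suc i)" "\<lambda>t. lin \<psi> (D' i t)" "dg' (Suc i)"]
      D_graded \<psi>D graded_vec_lin_ext[OF D'_free D'_graded \<psi>(2)] by blast
  have \<phi>_chain: "lin (D' i) (lin \<phi>' u) = lin \<phi> (lin (D i) u)" if "u \<in> free_module (R (Suc i))" for u
    using \<phi>' by (simp add: lin_ext_comp[OF that] cong: lin_ext_cong[OF that])
  have \<psi>_chain: "lin (D i) (lin \<psi>' u) = lin \<psi> (lin (D' i) u)" if "u \<in> free_module (R' (Suc i))" for u
    using \<psi>' by (simp add: lin_ext_comp[OF that] cong: lin_ext_cong[OF that])
  \<comment> \<open>The new homotopy has to send the basis vector \<open>t\<close> to a preimage of \<open>z t\<close>, which exists since \<open>z t\<close> is a cycle.\<close>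
  define z where "z = (\<lambda>t. Poly_Mapping.single t 1 - lin \<psi>' (\<phi>' t) - lin h (D i t))"
  have z: "z t \<in> lin (D (Suc i)) ` free_module (R (Suc (Suc i))) \<and> graded_vec (dg (Suc i)) (dg (Suc i) t) (z t)"
    if t: "t < R (Suc i)" for t
  proof
    have "z t \<in> free_module (R (Suc i))"
      unfolding z_def using t \<phi>' \<psi>' h(1) D_free[OF t]
      by (intro free.subspace_diff[OF subspace_free_module] single_in_free_module lin_ext_in_free_module) auto
    moreover have "lin (D i) (z t) = 0"
      using t \<phi>' \<psi>_chain[of "\<phi>' t"] hD[OF t] by (simp add: z_def lin_ext_diff)
    ultimately show "z t \<in> lin (D (Suc i)) ` free_module (R (Suc (Suc i)))" using ker_D[of i] by blast
    have "graded_vec (dg (Suc i)) (dg (Suc i) t) (Poly_Mapping.single t 1 :: ('v, 'k) fvec)"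
      by (auto simp: graded_vec_def lookup_single when_def in_homogeneous_iff lookup_one)
    moreover have "graded_vec (dg (Suc i)) (dg (Suc i) t) (lin \<psi>' (\<phi>' t))"
      using graded_vec_lin_ext[of "\<phi>' t" "R' (Suc i)" "dg' (Suc i)" _ "dg (Suc i)" \<psi>'] \<phi>' \<psi>' t by blast
    moreover have "graded_vec (dg (Suc i)) (dg (Suc i) t) (lin h (D i t))"
      using graded_vec_lin_ext[OF D_free[OF t] D_graded[OF t] h(2)] by blast
    ultimately show "graded_vec (dg (Suc i)) (dg (Suc i) t) (z t)" by (simp add: z_def graded_vec_diff)
  qed
  obtain h' where h': "\<forall>t<R (Suc i). h' t \<in> free_module (R (Suc (Suc i))) \<and>
      graded_vec (dg (Suc (Suc i))) (dg (Suc i) t) (h' t) \<and> lin (D (Suc i)) (h' t) = z t"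
    using lift_basis[of "R (Suc (Suc i))" "dg (Suc i)" "dg (Suc (Suc i))" "D (Suc i)" "R (Suc i)" z "dg (Suc i)"]
      D_graded z by blast
  have homotopy: "lin (D (Suc i)) (lin h' u) = u - lin \<psi>' (lin \<phi>' u) - lin h (lin (D i) u)"
    if u: "u \<in> free_module (R (Suc i))" for u
  proof -
    have "lin (D (Suc i)) (lin h' u) = lin z u"
      unfolding lin_ext_comp[OF u] by (rule lin_ext_cong[OF u]) (use h' in auto)
    then show ?thesis by (simp add: z_def lin_ext_minus_fun lin_ext_basis lin_ext_comp[OF u])
  qed
  have "lin \<phi>' (D (Suc i) t) \<in> lin (D' (Suc i)) ` free_module (R' (Suc (Suc i)))" if t: "t < R (Suc (Suc i))" for t
  proof -
    have "lin \<phi>' (D (Suc i) t) \<in> free_module (R' (Suc i))"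
      by (rule lin_ext_in_free_module[OF D_free[OF t]]) (use \<phi>' in blast)
    moreover have "lin (D' i) (lin \<phi>' (D (Suc i) t)) = 0" by (simp add: \<phi>_chain[OF D_free[OF t]] D_D[OF t])
    ultimately show ?thesis using ker_D'[of i] by blast
  qed
  moreover have "lin \<psi>' (D' (Suc i) t) \<in> lin (D (Suc i)) ` free_module (R (Suc (Suc i)))" if t: "t < R' (Suc (Suc i))" for t
  proof -
    have "lin \<psi>' (D' (Suc i) t) \<in> free_module (R (Suc i))"
      by (rule lin_ext_in_free_module[OF D'_free[OF t]]) (use \<psi>' in blast)
    moreover have "lin (D i) (lin \<psi>' (D' (Suc i) t)) = 0" by (simp add: \<psi>_chain[OF D'_free[OF t]] D'_D'[OF t])
    ultimately show ?thesis using ker_D[of i] by blast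
  qed
  moreover have "lin (D (Suc i)) (lin h' (D (Suc i) t)) = D (Suc i) t - lin \<psi>' (lin \<phi>' (D (Suc i) t))"
    if t: "t < R (Suc (Suc i))" for t
    using homotopy[OF D_free[OF t]] D_D[OF t] by simp
  ultimately have "comparison (Suc i) \<phi>' \<psi>' h'" using \<phi>' \<psi>' h' by (simp add: comparison_def)
  then show ?thesis using homotopy by blast
qed

text \<open>The identity and \<open>\<psi> \<circ> \<phi>\<close> differ by the homotopy. At
  the bottom both chain maps are the identity, so the homotopy can start with 0.\<close>

lemma homotopy_equivalence:
  "\<exists>\<phi> \<psi> h h'. comparison (Suc i) \<phi> \<psi> h' \<and> (i = 0 \<longrightarrow> h = (\<lambda>_. 0)) \<and>
     (\<forall>u\<in>free_module (R (Suc i)). lin (D (Suc i)) (lin h' u) = u - lin \<psi> (lin \<phi> u) - lin h (lin (D i) u))"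
proof -
  have "\<exists>\<phi> \<psi> h. comparison i \<phi> \<psi> h \<and> (i = 0 \<longrightarrow> h = (\<lambda>_. 0))"
    by (induction i) (use comparison_0 comparison_step in \<open>blast, metis nat.distinct(1)\<close>)
  then show ?thesis using comparison_step by metis
qed

end

section \<open>Betti numbers\<close>

text \<open>A resolution of an ideal with its augmentation added as the lowest differential, the target
  of the augmentation being the polynomial ring as a free module of rank one. The
  homological degree is therefore shifted by one.\<close>

definition aug_rank :: "('v, 'k::field, 'm) free_complex \<Rightarrow> nat \<Rightarrow> nat" where
  "aug_rank F i = (case i of 0 \<Rightarrow> 1 | Suc i' \<Rightarrow> fr_rank F i')"

definition aug_degree :: "('v, 'k::field, 'm) free_complex \<Rightarrow> nat \<Rightarrow> nat \<Rightarrow> int" where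
  "aug_degree F i t = (case i of 0 \<Rightarrow> 0 | Suc i' \<Rightarrow> fr_degree F i' t)"

definition aug_diff :: "('v, 'k::field, ('v, 'k) mpoly) free_complex \<Rightarrow> nat \<Rightarrow> nat \<Rightarrow> (nat \<Rightarrow>\<^sub>0 ('v, 'k) mpoly)" where
  "aug_diff F i t = (case i of 0 \<Rightarrow> Poly_Mapping.single 0 (fr_aug F t) | Suc i' \<Rightarrow> fr_diff F i' t)"

lemma aug_simps [simp]:
  "aug_rank F 0 = 1" "aug_rank F (Suc i) = fr_rank F i"
  "aug_degree F 0 = (\<lambda>_. 0)" "aug_degree F (Suc i) = fr_degree F i"
  "aug_diff F' 0 = (\<lambda>t. Poly_Mapping.single 0 (fr_aug F' t))" "aug_diff F' (Suc i) = fr_diff F' i"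
  by (auto simp: aug_rank_def aug_degree_def aug_diff_def)

lemma augmented_resolution:
  fixes F :: "('v::finite, 'k::field, ('v, 'k) mpoly) free_complex"
  assumes F: "graded_free_resolution (ideal_module I) F"
  shows "graded_exact (aug_rank F) (aug_degree F) (aug_diff F)"
    and "lin_ext free_scale (aug_diff F 0) ` free_module (aug_rank F 1) = Poly_Mapping.single 0 ` I"
proof -
  have aug: "fr_aug F t \<in> homogeneous (fr_degree F 0 t)" if "t < fr_rank F 0" for t
    using F that by (auto simp: graded_free_resolution_def ideal_module_def)
  have diff: "fr_diff F i t \<in> free_module (fr_rank F i)"
    "s < fr_rank F i \<Longrightarrow> lk (fr_diff F i t) s \<in> homogeneous (fr_degree F (Suc i) t - fr_degree F i s)"
    if "t < fr_rank F (Suc i)" for i t s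
    using F that by (auto simp: graded_free_resolution_def)
  have image: "lin_ext (*) (fr_aug F) ` free_module (fr_rank F 0) = I"
    and ker0: "{v \<in> free_module (fr_rank F 0). lin_ext (*) (fr_aug F) v = 0}
       = lin_ext free_scale (fr_diff F 0) ` free_module (fr_rank F 1)"
    and ker: "{v \<in> free_module (fr_rank F (Suc i)). lin_ext free_scale (fr_diff F i) v = 0}
       = lin_ext free_scale (fr_diff F (Suc i)) ` free_module (fr_rank F (Suc (Suc i)))" for i
    using F by (simp_all add: graded_free_resolution_def ideal_module_def)
  show "graded_exact (aug_rank F) (aug_degree F) (aug_diff F)"
    unfolding graded_exact_def
  proof (intro conjI allI impI)
    fix i t assume t: "t < aug_rank F (Suc i)"
    show "aug_diff F i t \<in> free_module (aug_rank F i)"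
      using t diff(1) by (cases i) (auto intro: single_in_free_module)
    show "graded_vec (aug_degree F i) (aug_degree F (Suc i) t) (aug_diff F i t)"
    proof (cases i)
      case 0
      then show ?thesis using t aug by (auto simp: graded_vec_def lookup_single when_def)
    next
      case (Suc j)
      have "lk (fr_diff F j t) s \<in> homogeneous (fr_degree F (Suc j) t - fr_degree F j s)" for s
      proof (cases "s < fr_rank F j")
        case False
        then have "lk (fr_diff F j t) s = 0" using diff(1)[of t j] t Suc by (simp add: free_module_iff)
        then show ?thesis by simp
      qed (use diff(2) t Suc in simp)
      then show ?thesis by (simp add: Suc graded_vec_def)
    qed
  next
    fix i
    show "{v \<in> free_module (aug_rank F (Suc i)). lin_ext free_scale (aug_diff F i) v = 0}
       = lin_ext free_scale (aug_diff F (Suc i)) ` free_module (aug_rank F (Suc (Suc i)))"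
    proof (cases i)
      case 0
      have "Poly_Mapping.single (0::nat) p = 0 \<longleftrightarrow> p = 0" for p :: "('v, 'k) mpoly"
        by (metis lookup_single_eq lookup_zero single_zero)
      then show ?thesis using ker0 by (simp add: 0 lin_ext_single0)
    next
      case (Suc j)
      then show ?thesis using ker by simp
    qed
  qed
  show "lin_ext free_scale (aug_diff F 0) ` free_module (aug_rank F 1) = Poly_Mapping.single 0 ` I"
    using image by (auto simp: lin_ext_single0)
qed

text \<open>Reduction modulo the ideal of all variables.\<close>

abbreviation constant_terms :: "('v, 'k::field) fvec \<Rightarrow> (nat \<Rightarrow>\<^sub>0 'k)" where
  "constant_terms \<equiv> Poly_Mapping.map (\<lambda>p. lk p 0)"

lemma lookup_constant_terms: "lk (constant_terms v) t = lk (lk v t) 0"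
  by (simp add: map.rep_eq when_def)

lemma lookup_mult_0: "lk (f * g) 0 = lk f 0 * lk (g :: ('v, 'k::field) mpoly) 0"
proof -
  have "Sum_any (\<lambda>q. lk g q when 0 = l + q) = (lk g 0 when l = 0)" for l :: "'v \<Rightarrow>\<^sub>0 nat"
  proof -
    have "0 = l + q \<longleftrightarrow> l = 0 \<and> q = 0" for q
      by (auto simp: poly_mapping_eq_iff fun_eq_iff lookup_add)
    then have "(\<lambda>q. lk g q when 0 = l + q) = (\<lambda>q. (lk g q when l = 0) when q = 0)"
      by (auto simp: when_def fun_eq_iff)
    then show ?thesis by (simp only: Sum_any_when_equal)
  qed
  then show ?thesis by (simp add: lookup_mult mult_when)
qed

lemma constant_terms_lin_ext:
  assumes v: "v \<in> free_module n"
  shows "constant_terms (lin_ext free_scale b v) = lin_ext free_scale (\<lambda>t. constant_terms (b t)) (constant_terms v)"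
proof (rule poly_mapping_eqI)
  fix s
  have "constant_terms v \<in> free_module n" using v by (simp add: free_module_iff lookup_constant_terms)
  then show "lk (constant_terms (lin_ext free_scale b v)) s =
      lk (lin_ext free_scale (\<lambda>t. constant_terms (b t)) (constant_terms v)) s"
    by (simp add: lookup_constant_terms lookup_lin_ext[OF v] lookup_lin_ext lookup_sum lookup_mult_0)
qed

lemma constant_terms_tensor_diff:
  "v \<in> free_module n \<Longrightarrow> constant_terms (lin_ext free_scale (fr_diff F i) v) = tensor_diff F i (constant_terms v)"
  by (simp add: tensor_diff_def constant_terms_lin_ext)

lemma constant_terms_diff: "constant_terms (u - v) = constant_terms u - constant_terms v"
  by (rule poly_mapping_eqI) (simp add: lookup_constant_terms lookup_minus)

lemma constant_terms_zero [simp]: "constant_terms 0 = 0"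
  by (rule poly_mapping_eqI) (simp add: lookup_constant_terms)

lemma constant_terms_graded:
  fixes F :: "('v::finite, 'k::field, 'm) free_complex" and v :: "('v, 'k) fvec"
  assumes "v \<in> free_module (fr_rank F i)" "graded_vec (fr_degree F i) j v"
  shows "constant_terms v \<in> tensor_part F i j"
proof -
  have "fr_degree F i t = j" if "lk (lk v t) 0 \<noteq> 0" for t
  proof -
    have "lk v t \<in> homogeneous (j - fr_degree F i t)" using assms(2) by (simp add: graded_vec_def)
    then have "int (exp_degree (0 :: 'v \<Rightarrow>\<^sub>0 nat)) = j - fr_degree F i t" using that unfolding in_homogeneous_iff by blast
    then show ?thesis by (simp add: exp_degree_def)
  qed
  then show ?thesis
    using assms(1) by (auto simp: tensor_part_def free_module_iff lookup_constant_terms in_keys_iff)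
qed

lemma tensor_part_lift:
  fixes F :: "('v::finite, 'k::field, 'm) free_complex"
  assumes "v \<in> tensor_part F i j"
  obtains w :: "('v, 'k) fvec" where "w \<in> free_module (fr_rank F i)" "graded_vec (fr_degree F i) j w" "constant_terms w = v"
proof -
  let ?w = "Poly_Mapping.map (\<lambda>c. Poly_Mapping.single 0 c) v :: ('v, 'k) fvec"
  have w: "lk ?w t = Poly_Mapping.single 0 (lk v t)" for t by (simp add: map.rep_eq when_def)
  have "?w \<in> free_module (fr_rank F i)" using assms by (simp add: free_module_iff w tensor_part_def)
  moreover have "Poly_Mapping.single 0 (lk v t) \<in> (homogeneous (j - fr_degree F i t) :: ('v, 'k) mpoly set)" for t
    using assms by (auto simp: tensor_part_def in_keys_iff in_homogeneous_iff lookup_single when_def exp_degree_def)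
  then have "graded_vec (fr_degree F i) j ?w" by (simp add: graded_vec_def w)
  moreover have "constant_terms ?w = v" by (rule poly_mapping_eqI) (simp add: lookup_constant_terms w)
  ultimately show thesis by (rule that)
qed

text \<open>Lift a cycle of degree \<open>j\<close> of the reduced complex to a vector \<open>w\<close> with
  constant entries, and apply the homotopy formula to it. The image of \<open>w\<close> under
  \<open>\<phi>\<close> is homogeneous of degree \<open>j\<close> in a free module whose basis
  vectors all have degree \<open>d + i\<close>, so for \<open>j \<noteq> d + i\<close> it
  vanishes modulo the variables. The differential of \<open>w\<close> vanishes modulo the variables
  because \<open>w\<close> lifts a cycle. What is left says that the cycle is a boundary.\<close>

lemma tor_vanishes_off_diagonal:
  fixes F G :: "('v::finite, 'k::field, ('v, 'k) mpoly) free_complex"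
  assumes F: "graded_free_resolution (ideal_module I) F" and G: "graded_free_resolution (ideal_module I) G"
    and deg: "\<And>i t. fr_degree G i t = d + int i" and j: "j \<noteq> d + int i"
  shows "tor_cycles F i j = tor_boundaries F i j"
proof
  interpret two_resolutions "aug_rank F" "aug_rank G" "aug_degree F" "aug_degree G" "aug_diff F" "aug_diff G"
    using augmented_resolution[OF F] augmented_resolution[OF G] by unfold_locales simp_all
  show "tor_cycles F i j \<subseteq> tor_boundaries F i j"
  proof
    fix v assume v: "v \<in> tor_cycles F i j"
    then obtain w :: "('v, 'k) fvec" where w: "w \<in> free_module (fr_rank F i)" "graded_vec (fr_degree F i) j w" "constant_terms w = v"
      using tensor_part_lift[of v F i j] unfolding tor_cycles_def by blast
    obtain \<phi> \<psi> h h' where comp: "comparison (Suc i) \<phi> \<psi> h'" and h0: "i = 0 \<Longrightarrow> h = (\<lambda>_. 0)"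
      and homotopy: "\<And>u. u \<in> free_module (fr_rank F i) \<Longrightarrow> lin_ext free_scale (fr_diff F i) (lin_ext free_scale h' u) =
         u - lin_ext free_scale \<psi> (lin_ext free_scale \<phi> u) - lin_ext free_scale h (lin_ext free_scale (aug_diff F i) u)"
      using homotopy_equivalence[of i] unfolding aug_simps by blast
    have \<phi>: "t < fr_rank F i \<Longrightarrow> \<phi> t \<in> free_module (fr_rank G i)"
        "t < fr_rank F i \<Longrightarrow> graded_vec (fr_degree G i) (fr_degree F i t) (\<phi> t)"
      and h': "t < fr_rank F i \<Longrightarrow> h' t \<in> free_module (fr_rank F (Suc i))"
        "t < fr_rank F i \<Longrightarrow> graded_vec (fr_degree F (Suc i)) (fr_degree F i t) (h' t)" for t
      using comp by (simp_all add: comparison_def)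
    have \<phi>w: "lin_ext free_scale \<phi> w \<in> free_module (fr_rank G i)"
      by (rule lin_ext_in_free_module[OF w(1) \<phi>(1)])
    have "graded_vec (fr_degree G i) j (lin_ext free_scale \<phi> w)"
      by (rule graded_vec_lin_ext[OF w(1,2) \<phi>(2)])
    then have "constant_terms (lin_ext free_scale \<phi> w) \<in> tensor_part G i j"
      by (rule constant_terms_graded[OF \<phi>w])
    then have "Poly_Mapping.keys (constant_terms (lin_ext free_scale \<phi> w)) = {}"
      using j deg by (auto simp: tensor_part_def)
    then have \<phi>0: "constant_terms (lin_ext free_scale \<phi> w) = 0" by simp
    have h'w: "lin_ext free_scale h' w \<in> free_module (fr_rank F (Suc i))"
      by (rule lin_ext_in_free_module[OF w(1) h'(1)])
    have "graded_vec (fr_degree F (Suc i)) j (lin_ext free_scale h' w)"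
      by (rule graded_vec_lin_ext[OF w(1,2) h'(2)])
    then have in_part: "constant_terms (lin_ext free_scale h' w) \<in> tensor_part F (Suc i) j"
      by (rule constant_terms_graded[OF h'w])
    \<comment> \<open>In homological degree 0 every element is a cycle; there the term vanishes because \<open>h\<close> does.\<close>
    have "constant_terms (lin_ext free_scale h (lin_ext free_scale (aug_diff F i) w)) = 0"
    proof (cases i)
      case 0
      then show ?thesis by (simp add: h0 lin_ext_def)
    next
      case (Suc i')
      have "w \<in> free_module (fr_rank F (Suc i'))" using w(1) Suc by simp
      then have dw: "lin_ext free_scale (fr_diff F i') w \<in> free_module (fr_rank F i')"
        using lin_ext_in_free_module[of w _ "fr_diff F i'"] D_free[of _ "Suc i'"] by auto
      have "tensor_diff F i' v = 0" using v Suc by (simp add: tor_cycles_def)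
      then have "constant_terms (lin_ext free_scale (fr_diff F i') w) = 0"
        using constant_terms_tensor_diff[OF w(1), of F i'] w(3) by simp
      then show ?thesis by (simp add: Suc constant_terms_lin_ext[OF dw])
    qed
    then have "constant_terms (lin_ext free_scale (fr_diff F i) (lin_ext free_scale h' w)) = v"
      by (simp add: homotopy[OF w(1)] constant_terms_diff constant_terms_lin_ext[OF \<phi>w] \<phi>0 w(3))
    then have "v = tensor_diff F i (constant_terms (lin_ext free_scale h' w))"
      by (simp add: constant_terms_tensor_diff[OF h'w])
    then show "v \<in> tor_boundaries F i j" using in_part by (simp add: tor_boundaries_def)
  qed
  show "tor_boundaries F i j \<subseteq> tor_cycles F i j"
  proof
    fix v assume "v \<in> tor_boundaries F i j"
    then obtain x where x: "x \<in> tensor_part F (Suc i) j" "v = tensor_diff F i x" by (auto simp: tor_boundaries_def)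
    obtain w :: "('v, 'k) fvec" where w: "w \<in> free_module (fr_rank F (Suc i))" "graded_vec (fr_degree F (Suc i)) j w" "constant_terms w = x"
      using tensor_part_lift[OF x(1)] by blast
    let ?dw = "lin_ext free_scale (fr_diff F i) w"
    have v: "v = constant_terms ?dw" using constant_terms_tensor_diff[OF w(1), of F i] w(3) x(2) by simp
    have dw: "?dw \<in> free_module (fr_rank F i)"
      by (rule lin_ext_in_free_module[OF w(1)]) (use D_free[of _ "Suc i"] in simp)
    have "graded_vec (fr_degree F i) j ?dw"
      by (rule graded_vec_lin_ext[OF w(1,2)]) (use D_graded[of _ "Suc i"] in simp)
    then have "v \<in> tensor_part F i j" unfolding v by (rule constant_terms_graded[OF dw])
    moreover have "tensor_diff F i' v = 0" if i: "i = Suc i'" for i'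
    proof -
      have "?dw \<in> lin_ext free_scale (fr_diff F (Suc i')) ` free_module (fr_rank F (Suc (Suc i')))"
        using w(1) i by blast
      then have "lin_ext free_scale (fr_diff F i') ?dw = 0" using ker_D[of "Suc i'"] by auto
      then show ?thesis using constant_terms_tensor_diff[OF dw, of F i'] v by simp
    qed
    ultimately show "v \<in> tor_cycles F i j" by (auto simp: tor_cycles_def split: nat.split)
  qed
qed

text \<open>The Betti numbers are computed from a resolution about which nothing is known. The linear
  resolution shows that the choice picks a resolution at all, and the comparison transfers
  the vanishing to it.\<close>

lemma linear_resolution_of_linear_order:
  assumes us: "linear_order_list us" and deg: "\<And>u. u \<in> set us \<Longrightarrow> int (exp_degree u) = d"
  shows "linear_resolution (ideal_module (ideal_gen (monomial ` set us) :: ('v::finite, 'k::field) mpoly set))"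
proof -
  let ?M = "ideal_module (ideal_gen (monomial ` set us) :: ('v, 'k) mpoly set)"
  obtain G where G: "graded_free_resolution ?M G" "\<And>i t. fr_degree G i t = d + int i"
    using linear_free_resolution_exists[OF us, of d] deg by blast
  have F: "graded_free_resolution ?M (SOME F. graded_free_resolution ?M F)"
    using G(1) by (rule someI)
  have "betti ?M i (int i + b) = 0" if "b \<noteq> d" for i b
    using tor_vanishes_off_diagonal[OF F G, of "int i + b" i] that by (simp add: betti_def)
  then show ?thesis unfolding linear_resolution_def by blast
qed

theorem corollary3p4:
  fixes E :: "'v::finite set set"
    and k :: nat
  assumes "tree_graph E"
    and "k \<ge> 1"
  shows "linear_quotients (ideal_power (vertex_cover_ideal E :: ('v, 'k::field) mpoly set) k) \<and>
         componentwise_linear (ideal_power (vertex_cover_ideal E :: ('v, 'k) mpoly set) k)"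
proof -
  let ?w = "edge_weight E k"
  let ?J = "polys_on (weighted_covers ?w) :: ('v, 'k) mpoly set"
  have w: "forest_weight ?w" by (rule forest_edge_weight[OF assms(1)])
  have power: "ideal_power (vertex_cover_ideal E) k = ?J"
    by (rule ideal_power_vertex_cover_ideal[OF assms(1)])
  have "linear_quotients (polys_on (upward (minimal_covers ?w)) :: ('v, 'k) mpoly set)"
    by (rule linear_quotientsI[OF minimal_covers_linearly_orderable[OF w]]) (auto simp: minimal_covers_def)
  then have "linear_quotients ?J" by (simp add: upward_minimal_covers)
  moreover have "graded_ideal ?J"
    using graded_ideal_polys_on[of "minimal_covers ?w"] by (simp add: upward_minimal_covers)
  moreover have "linear_resolution (ideal_module (ideal_gen (?J \<inter> homogeneous j)))" for j
  proof -
    obtain us where us: "linear_order_list us" "\<And>u. u \<in> set us \<Longrightarrow> int (exp_degree u) = j"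
      "ideal_gen (?J \<inter> homogeneous j) = ideal_gen (monomial ` set us)"
      using truncated_cover_ideal[OF w] by metis
    then show ?thesis using linear_resolution_of_linear_order[OF us(1), of j] by simp
  qed
  ultimately show ?thesis unfolding power componentwise_linear_def by blast
qed

end
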